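(* Let $G\subset\mathbb{R}^2$ be the Bear tile, i.e. $G=\{\sum_{k=1}^{\infty}M^{-k}\Delta_k : \Delta_k\in D\}$ with $M=\begin{pmatrix}1&-2\\1&0\end{pmatrix}$ and $D=\{(0,0)^T,(1,0)^T\}$. Let Bear-3 be the function $B_2^G=\chi_G*\chi_G*\chi_G$ and Bear-4 the function $B_3^G=\chi_G*\chi_G*\chi_G*\chi_G$. Then Bear-3 belongs to $C^2(\mathbb{R}^2)$ and Bear-4 belongs to $C^3(\mathbb{R}^2)$.
   Context: $\chi_G$ denotes the indicator function of $G$ and $*$ is convolution on $\mathbb{R}^2$. The tile B-spline $B_n^G$ of order $n$ is the convolution of $n+1$ copies of $\chi_G$; Bear-$k$ denotes $B_{k-1}^G$ for the Bear tile $G$. The set $G$ is compact, has Lebesgue measure $1$, and its integer translates tile $\mathbb{R}^2$ up to measure zero. $C^r(\mathbb{R}^2)$ is the space of $r$ times continuously differentiable functions. *)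

theory Defs
  imports "HOL-Analysis.Analysis"
begin

(* On vectors of vectors the operator ^ would be the componentwise power. *)
primrec mat_power :: "real^'n^'n \<Rightarrow> nat \<Rightarrow> real^'n^'n" where
  "mat_power A 0 = mat 1"
| "mat_power A (Suc k) = A ** mat_power A k"

(* The sequence of digits starts at k = 1, so \<Delta> 0 is ignored. *)
definition tile :: "real^'n^'n \<Rightarrow> (real^'n) set \<Rightarrow> (real^'n) set" where
  "tile M D = {x. \<exists>\<Delta>::nat \<Rightarrow> real^'n. (\<forall>k\<ge>1. \<Delta> k \<in> D) \<and>
     (\<lambda>k. mat_power (matrix_inv M) (Suc k) *v \<Delta> (Suc k)) sums x}"

definition bear_matrix :: "real^2^2" where
  "bear_matrix = vector [vector [1, -2], vector [1, 0]]"

definition bear_digits :: "(real^2) set" where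
  "bear_digits = {vector [0, 0], vector [1, 0]}"

definition bear_tile :: "(real^2) set" where
  "bear_tile = tile bear_matrix bear_digits"

definition convolution ::
  "('a::euclidean_space \<Rightarrow> real) \<Rightarrow> ('a \<Rightarrow> real) \<Rightarrow> 'a \<Rightarrow> real" where
  "convolution f g x = (\<integral>t. f t * g (x - t) \<partial>lborel)"

(* The convolution of n + 1 copies of the indicator function. *)
primrec tile_bspline :: "'a::euclidean_space set \<Rightarrow> nat \<Rightarrow> 'a \<Rightarrow> real" where
  "tile_bspline G 0 = indicator G"
| "tile_bspline G (Suc n) = convolution (tile_bspline G n) (indicator G)"

(* The derivative of f has another type than f, so the recursion goes through
   the directional derivatives x \<mapsto> Df(x) v.  In finite dimension these are
   C^r for all v iff x \<mapsto> Df(x) is C^r. *)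
primrec times_cont_differentiable ::
  "nat \<Rightarrow> ('a::euclidean_space \<Rightarrow> 'b::real_normed_vector) \<Rightarrow> bool" where
  "times_cont_differentiable 0 f \<longleftrightarrow> continuous_on UNIV f"
| "times_cont_differentiable (Suc r) f \<longleftrightarrow>
     (\<forall>x. f differentiable (at x)) \<and>
     (\<forall>v. times_cont_differentiable r (\<lambda>x. frechet_derivative f (at x) v))"

end

theory Submission
  imports Defs
begin

text \<open>
  A B-spline \<open>f\<close> of order \<open>q - 1\<close> satisfies \<open>f x = (\<Sum>k\<le>q. (q choose k) / 2 ^ (q - 1) * f (M x - k e1))\<close>,
  because the measure of \<open>G\<close> and \<open>M G = G \<union> (G + e1)\<close>, \<open>det M = 2\<close>, force the two halves to overlap in a
  null set. Iterating gives \<open>f x = (\<Sum>p. a\<^sub>n p * f (M\<^sup>n x - p))\<close> with an explicit subdivision sequence \<open>a\<^sub>n\<close>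
  on \<open>\<int>\<^sup>2\<close>, so the differences of \<open>f\<close> along the lattice \<open>M\<^sup>-\<^sup>n \<int>\<^sup>2\<close> are controlled by those of \<open>a\<^sub>n\<close>.
  The differences of order \<open>q\<close> at a point evolve by one of two matrices, depending on the residue of the
  point modulo \<open>M \<int>\<^sup>2\<close>, and a common quadratic Lyapunov form shows that they decay at a rate below
  \<open>2 powr (- (q - 1) / 2)\<close>, that is, faster than the power \<open>q - 1\<close> of the mesh size.

  Since \<open>M\<close> is conjugate to the multiplication by a complex number \<open>\<lambda>\<close> with \<open>\<bar>\<lambda>\<bar>\<^sup>2 = 2\<close>, the plane is
  identified with \<open>\<complex>\<close>, and the two complex combinations of unit differences that are eigenvectors of
  the refinement modulo second differences yield, after scaling by powers of \<open>\<lambda>\<close> and \<open>cnj \<lambda>\<close>,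
  uniformly convergent approximations of all partial derivatives up to order \<open>q - 1\<close>.
\<close>

section \<open>Certificates for positive semidefinite forms\<close>

text \<open>The eigenvalues of \<open>M\<close> are not real, so \<open>M\<close> preserves no
  direction: difference quotients along a lattice vector at successive meshes point in rotating
  directions and cannot be compared term by term. The complex combinations remove this obstacle, and
  their limits are, up to constant factors, the Wirtinger derivatives. From one mesh to the next, a
  scaled difference of order \<open>r\<close> changes by differences of order \<open>r + 1\<close>
  times a factor of size \<open>2 powr (r * n / 2)\<close>. These changes are summable once the
  differences of order \<open>r + 1\<close> decay faster than the \<open>r\<close>-th power of the
  mesh; \<open>r = q - 1\<close> fixes the rate that the certificates have to beat, and 255 / 256 is
  the margin that makes it strict. The order in which the two matrices act depends on the point, so
  their spectral radii alone do not control the products, whereas a quadratic form contracted by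
  both does.\<close>

definition dotp :: "int list \<Rightarrow> int list \<Rightarrow> int" where
  "dotp xs ys = sum_list (map2 (*) xs ys)"

definition mat_dim :: "nat \<Rightarrow> int list list \<Rightarrow> bool" where
  "mat_dim n A \<longleftrightarrow> length A = n \<and> list_all (\<lambda>r. length r = n) A"

definition row_gram :: "int list list \<Rightarrow> int list list \<Rightarrow> int list list" where
  "row_gram A B = map (\<lambda>r. map (dotp r) B) A"

definition mat_diff :: "int \<Rightarrow> int list list \<Rightarrow> int \<Rightarrow> int list list \<Rightarrow> int list list" where
  "mat_diff a A b B = map2 (map2 (\<lambda>x y. a * x - b * y)) A B"

text \<open>The row sum includes the diagonal entry, so the bound by twice that entry says that the
  diagonal is nonnegative and weakly dominates the rest of its row.\<close>

definition diag_dominant :: "nat \<Rightarrow> int list list \<Rightarrow> bool" where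
  "diag_dominant n E \<longleftrightarrow> list_all (\<lambda>i. list_all (\<lambda>j. E ! i ! j = E ! j ! i) [0..<n] \<and>
     sum_list (map abs (E ! i)) \<le> 2 * E ! i ! i) [0..<n]"

text \<open>\<open>row_gram L L\<close> is L L^T, and the tested remainder is c S - L L^T. Scaling
  by \<open>c\<close> makes an integer \<open>L\<close> a fine enough approximation of the Cholesky
  factor; with integer data the whole test is decided by evaluation.\<close>

definition psd_witness :: "nat \<Rightarrow> int list list \<Rightarrow> int \<times> int list list \<Rightarrow> bool" where
  "psd_witness n S W \<longleftrightarrow> (case W of (c, L) \<Rightarrow>
     c > 0 \<and> mat_dim n S \<and> mat_dim n L \<and> diag_dominant n (mat_diff c S 1 (row_gram L L)))"

definition quad_form :: "nat \<Rightarrow> int list list \<Rightarrow> (nat \<Rightarrow> real) \<Rightarrow> real" where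
  "quad_form n A u = (\<Sum>i<n. \<Sum>j<n. real_of_int (A ! i ! j) * u i * u j)"

lemma dotp_nth:
  assumes "length xs = n" "length ys = n"
  shows "dotp xs ys = (\<Sum>i<n. xs ! i * ys ! i)"
  using assms by (simp add: dotp_def sum_list_sum_nth atLeast0LessThan)

lemma mat_dim_nth: "mat_dim n A \<Longrightarrow> i < n \<Longrightarrow> length (A ! i) = n"
  by (simp add: mat_dim_def list_all_length)

lemma mat_dim_length: "mat_dim n A \<Longrightarrow> length A = n"
  by (simp add: mat_dim_def)

lemma row_gram_nth:
  assumes "mat_dim n A" "mat_dim n B" "i < n" "j < n"
  shows "row_gram A B ! i ! j = (\<Sum>k<n. A ! i ! k * B ! j ! k)"
  using assms
  by (simp add: row_gram_def mat_dim_length dotp_nth mat_dim_nth)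

lemma mat_dim_row_gram: "mat_dim n A \<Longrightarrow> mat_dim n B \<Longrightarrow> mat_dim n (row_gram A B)"
  by (simp add: mat_dim_def row_gram_def list_all_iff)

lemma mat_diff_nth:
  assumes "mat_dim n A" "mat_dim n B" "i < n" "j < n"
  shows "mat_diff a A b B ! i ! j = a * A ! i ! j - b * B ! i ! j"
  using assms by (simp add: mat_diff_def mat_dim_length mat_dim_nth)

lemma mat_dim_mat_diff:
  "mat_dim n A \<Longrightarrow> mat_dim n B \<Longrightarrow> mat_dim n (mat_diff a A b B)"
  by (auto simp: mat_diff_def mat_dim_def list_all_length)

lemma quad_form_mat_diff:
  assumes "mat_dim n A" "mat_dim n B"
  shows "quad_form n (mat_diff a A b B) u = a * quad_form n A u - b * quad_form n B u"
proof -
  have "quad_form n (mat_diff a A b B) u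
      = (\<Sum>i<n. \<Sum>j<n. a * (A ! i ! j * u i * u j) - b * (B ! i ! j * u i * u j))"
    unfolding quad_form_def using assms
    by (intro sum.cong refl) (simp add: mat_diff_nth algebra_simps)
  then show ?thesis
    by (simp only: quad_form_def sum_subtractf sum_distrib_left)
qed

lemma quad_form_row_gram:
  assumes "mat_dim n L"
  shows "quad_form n (row_gram L L) u = (\<Sum>k<n. (\<Sum>i<n. real_of_int (L ! i ! k) * u i)\<^sup>2)"
proof -
  have "quad_form n (row_gram L L) u
      = (\<Sum>i<n. \<Sum>j<n. \<Sum>k<n. (real_of_int (L ! i ! k) * u i) * (real_of_int (L ! j ! k) * u j))"
    unfolding quad_form_def using assms
    by (intro sum.cong refl) (simp add: row_gram_nth sum_distrib_right sum_distrib_left mult_ac)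
  also have "\<dots> = (\<Sum>i<n. \<Sum>k<n. \<Sum>j<n. (real_of_int (L ! i ! k) * u i) * (real_of_int (L ! j ! k) * u j))"
    by (intro sum.cong refl sum.swap)
  also have "\<dots> = (\<Sum>k<n. \<Sum>i<n. \<Sum>j<n. (real_of_int (L ! i ! k) * u i) * (real_of_int (L ! j ! k) * u j))"
    by (rule sum.swap)
  also have "\<dots> = (\<Sum>k<n. (\<Sum>i<n. real_of_int (L ! i ! k) * u i)\<^sup>2)"
    by (simp add: power2_eq_square sum_product)
  finally show ?thesis .
qed

text \<open>By 2 |x y| <= x^2 + y^2 an entry costs at most half its absolute value at each of two
  squares. By symmetry the total cost at the square of \<open>u i\<close> is the sum of row
  \<open>i\<close>, which dominance pays for.\<close>

lemma quad_form_diag_dominant: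
  assumes dim: "mat_dim n E" and dd: "diag_dominant n E"
  shows "0 \<le> quad_form n E u"
proof -
  define e where "e i j = real_of_int (E ! i ! j)" for i j
  have sym: "e i j = e j i" if "i < n" "j < n" for i j
    using dd that by (simp add: diag_dominant_def list_all_iff e_def)
  have dom: "(\<Sum>j<n. \<bar>e i j\<bar>) \<le> 2 * e i i" if "i < n" for i
  proof -
    have "sum_list (map abs (E ! i)) \<le> 2 * E ! i ! i"
      using dd that by (simp add: diag_dominant_def list_all_iff)
    moreover have "sum_list (map abs (E ! i)) = (\<Sum>j<n. \<bar>E ! i ! j\<bar>)"
      using that dim by (simp add: sum_list_sum_nth mat_dim_nth atLeast0LessThan)
    ultimately have "(\<Sum>j<n. \<bar>E ! i ! j\<bar>) \<le> 2 * E ! i ! i" by simp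
    then have "real_of_int (\<Sum>j<n. \<bar>E ! i ! j\<bar>) \<le> real_of_int (2 * E ! i ! i)"
      by (simp only: of_int_le_iff)
    then show ?thesis by (simp add: e_def)
  qed
  have split: "quad_form n E u = (\<Sum>i<n. \<Sum>j<n. e i j * u i * u j)"
    by (simp add: quad_form_def e_def)
  \<comment> \<open>A diagonal entry is written as twice itself minus its absolute value, so that
    the error terms run over full rows, as in \<open>dom\<close>.\<close>
  have low: "e i j * u i * u j \<ge> (if i = j then 2 * e i i * (u i)\<^sup>2 else 0)
      - \<bar>e i j\<bar> * ((u i)\<^sup>2 + (u j)\<^sup>2) / 2" if "i < n" for i j
  proof (cases "i = j")
    case True
    have "\<bar>e i i\<bar> \<le> (\<Sum>j<n. \<bar>e i j\<bar>)" using that by (intro member_le_sum) auto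
    then have "\<bar>e i i\<bar> = e i i" using dom[OF that] by linarith
    then show ?thesis using True by (simp only: refl if_True power2_eq_square) simp
  next
    case False
    have "\<bar>u i * u j\<bar> \<le> ((u i)\<^sup>2 + (u j)\<^sup>2) / 2"
      using sum_squares_bound[of "\<bar>u i\<bar>" "\<bar>u j\<bar>"] by (simp add: abs_mult)
    then have "\<bar>e i j\<bar> * \<bar>u i * u j\<bar> \<le> \<bar>e i j\<bar> * (((u i)\<^sup>2 + (u j)\<^sup>2) / 2)"
      by (intro mult_left_mono) auto
    then have "\<bar>e i j * u i * u j\<bar> \<le> \<bar>e i j\<bar> * ((u i)\<^sup>2 + (u j)\<^sup>2) / 2"
      by (simp add: abs_mult mult.assoc)
    then show ?thesis using False by simp
  qed
  have half: "(\<Sum>i<n. \<Sum>j<n. \<bar>e i j\<bar> * (u j)\<^sup>2) = (\<Sum>i<n. \<Sum>j<n. \<bar>e i j\<bar> * (u i)\<^sup>2)"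
    by (subst sum.swap) (intro sum.cong refl, auto simp only: lessThan_iff sym)
  have "(\<Sum>i<n. \<Sum>j<n. \<bar>e i j\<bar> * ((u i)\<^sup>2 + (u j)\<^sup>2) / 2)
      = ((\<Sum>i<n. \<Sum>j<n. \<bar>e i j\<bar> * (u i)\<^sup>2) + (\<Sum>i<n. \<Sum>j<n. \<bar>e i j\<bar> * (u j)\<^sup>2)) / 2"
    by (simp only: sum_divide_distrib[symmetric] distrib_left sum.distrib)
  also have "\<dots> = (\<Sum>i<n. (\<Sum>j<n. \<bar>e i j\<bar>) * (u i)\<^sup>2)"
    unfolding half by (simp add: sum_distrib_right)
  also have "\<dots> \<le> (\<Sum>i<n. 2 * e i i * (u i)\<^sup>2)"
    by (intro sum_mono mult_right_mono) (auto simp: dom)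
  finally have "0 \<le> (\<Sum>i<n. 2 * e i i * (u i)\<^sup>2)
      - (\<Sum>i<n. \<Sum>j<n. \<bar>e i j\<bar> * ((u i)\<^sup>2 + (u j)\<^sup>2) / 2)"
    by linarith
  also have "\<dots> = (\<Sum>i<n. \<Sum>j<n. (if i = j then 2 * e i i * (u i)\<^sup>2 else 0)
      - \<bar>e i j\<bar> * ((u i)\<^sup>2 + (u j)\<^sup>2) / 2)"
    by (simp add: sum_subtractf del: sum_divide_distrib)
  also have "\<dots> \<le> quad_form n E u"
    unfolding split by (intro sum_mono low) auto
  finally show ?thesis .
qed

lemma quad_form_psd_witness:
  assumes "psd_witness n S W"
  shows "0 \<le> quad_form n S u"
proof -
  obtain c L where W: "W = (c, L)" by force
  have c: "c > 0" and S: "mat_dim n S" and L: "mat_dim n L"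
    and dd: "diag_dominant n (mat_diff c S 1 (row_gram L L))"
    using assms by (auto simp: psd_witness_def W)
  have "0 \<le> quad_form n (mat_diff c S 1 (row_gram L L)) u"
    using dd S L by (intro quad_form_diag_dominant mat_dim_mat_diff mat_dim_row_gram)
  also have "\<dots> = c * quad_form n S u - quad_form n (row_gram L L) u"
    using S L by (simp add: quad_form_mat_diff mat_dim_row_gram)
  finally have "0 \<le> c * quad_form n S u - quad_form n (row_gram L L) u" .
  moreover have "quad_form n (row_gram L L) u \<ge> 0"
    using L by (simp add: quad_form_row_gram sum_nonneg)
  ultimately have "0 \<le> c * quad_form n S u" by linarith
  then show ?thesis using c by (simp add: zero_le_mult_iff)
qed

text \<open>\<open>row_gram C (row_gram C Q)\<close> is C Q C^T even for a nonsymmetric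
  \<open>Q\<close>: the inner product transposes \<open>Q\<close> and the outer one transposes it
  back.\<close>

lemma quad_form_congruence:
  assumes Q: "mat_dim n Q" and C: "mat_dim n C"
  shows "quad_form n (row_gram C (row_gram C Q)) u
       = quad_form n Q (\<lambda>k. \<Sum>i<n. real_of_int (C ! i ! k) * u i)"
proof -
  let ?t = "\<lambda>i j k l. real_of_int (Q ! k ! l) * ((real_of_int (C ! i ! k) * u i) * (real_of_int (C ! j ! l) * u j))"
  have "quad_form n (row_gram C (row_gram C Q)) u = (\<Sum>i<n. \<Sum>j<n. \<Sum>k<n. \<Sum>l<n. ?t i j k l)"
    unfolding quad_form_def
  proof (intro sum.cong refl)
    fix i j assume "i \<in> {..<n}" "j \<in> {..<n}"
    then have "row_gram C (row_gram C Q) ! i ! j = (\<Sum>k<n. C ! i ! k * (\<Sum>l<n. C ! j ! l * Q ! k ! l))"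
      using assms by (simp add: row_gram_nth mat_dim_row_gram)
    then show "row_gram C (row_gram C Q) ! i ! j * u i * u j = (\<Sum>k<n. \<Sum>l<n. ?t i j k l)"
      by (simp add: sum_distrib_left sum_distrib_right mult_ac)
  qed
  also have "\<dots> = (\<Sum>i<n. \<Sum>k<n. \<Sum>j<n. \<Sum>l<n. ?t i j k l)"
    by (intro sum.cong refl sum.swap)
  also have "\<dots> = (\<Sum>k<n. \<Sum>i<n. \<Sum>j<n. \<Sum>l<n. ?t i j k l)"
    by (rule sum.swap)
  also have "\<dots> = (\<Sum>k<n. \<Sum>i<n. \<Sum>l<n. \<Sum>j<n. ?t i j k l)"
    by (intro sum.cong refl sum.swap)
  also have "\<dots> = (\<Sum>k<n. \<Sum>l<n. \<Sum>i<n. \<Sum>j<n. ?t i j k l)"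
    by (intro sum.cong refl sum.swap)
  also have "\<dots> = quad_form n Q (\<lambda>k. \<Sum>i<n. real_of_int (C ! i ! k) * u i)"
    unfolding quad_form_def
  proof (intro sum.cong refl)
    fix k l
    have "real_of_int (Q ! k ! l) * (\<Sum>i<n. real_of_int (C ! i ! k) * u i) * (\<Sum>i<n. real_of_int (C ! i ! l) * u i)
        = real_of_int (Q ! k ! l) * ((\<Sum>i<n. real_of_int (C ! i ! k) * u i) * (\<Sum>i<n. real_of_int (C ! i ! l) * u i))"
      by (rule mult.assoc)
    then show "(\<Sum>i<n. \<Sum>j<n. ?t i j k l)
        = real_of_int (Q ! k ! l) * (\<Sum>i<n. real_of_int (C ! i ! k) * u i) * (\<Sum>i<n. real_of_int (C ! i ! l) * u i)"
      unfolding sum_product unfolding sum_distrib_left by (rule sym)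
  qed
  finally show ?thesis .
qed

section \<open>Contraction of the differences of the subdivision sequence\<close>

definition mat_one :: "nat \<Rightarrow> int list list" where
  "mat_one n = map (\<lambda>i. map (\<lambda>j. if i = j then 1 else 0) [0..<n]) [0..<n]"

lemma quad_form_mat_one: "quad_form n (mat_one n) u = (\<Sum>i<n. (u i)\<^sup>2)"
proof -
  have "quad_form n (mat_one n) u = (\<Sum>i<n. \<Sum>j<n. if i = j then (u i)\<^sup>2 else 0)"
    unfolding quad_form_def
    by (intro sum.cong refl) (auto simp: mat_one_def power2_eq_square)
  then show ?thesis by simp
qed

lemma mat_dim_mat_one: "mat_dim n (mat_one n)"
  by (simp add: mat_dim_def mat_one_def list_all_iff)

section \<open>Stencils: difference functionals on sequences over the integer lattice\<close>

type_synonym stencil = "(int \<times> int \<times> int) list"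

definition apply_stencil :: "stencil \<Rightarrow> (int \<Rightarrow> int \<Rightarrow> real) \<Rightarrow> int \<Rightarrow> int \<Rightarrow> real" where
  "apply_stencil w g a b = (\<Sum>(u, v, c)\<leftarrow>w. real_of_int c * g (a - u) (b - v))"

definition diff1 :: "(int \<Rightarrow> int \<Rightarrow> 'a::ab_group_add) \<Rightarrow> int \<Rightarrow> int \<Rightarrow> 'a" where
  "diff1 g a b = g a b - g (a - 1) b"

definition diff2 :: "(int \<Rightarrow> int \<Rightarrow> 'a::ab_group_add) \<Rightarrow> int \<Rightarrow> int \<Rightarrow> 'a" where
  "diff2 g a b = g a b - g a (b - 1)"

definition diff1_stencil :: "stencil \<Rightarrow> stencil" where
  "diff1_stencil w = w @ map (\<lambda>(u, v, c). (u + 1, v, - c)) w"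

definition diff2_stencil :: "stencil \<Rightarrow> stencil" where
  "diff2_stencil w = w @ map (\<lambda>(u, v, c). (u, v + 1, - c)) w"

definition diff_stencil :: "nat \<times> nat \<times> int \<times> int \<Rightarrow> stencil" where
  "diff_stencil = (\<lambda>(i, j, u, v). (diff1_stencil ^^ i) ((diff2_stencil ^^ j) [(u, v, 1)]))"

lemma apply_stencil_Nil [simp]: "apply_stencil [] g a b = 0"
  by (simp add: apply_stencil_def)

lemma apply_stencil_Cons [simp]:
  "apply_stencil ((u, v, c) # w) g a b = real_of_int c * g (a - u) (b - v) + apply_stencil w g a b"
  by (simp add: apply_stencil_def)

lemma apply_stencil_append [simp]:
  "apply_stencil (w @ w') g a b = apply_stencil w g a b + apply_stencil w' g a b"
  by (simp add: apply_stencil_def)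

lemma apply_diff1_stencil: "apply_stencil (diff1_stencil w) g a b = apply_stencil w (diff1 g) a b"
proof -
  have "apply_stencil (map (\<lambda>(u, v, c). (u + 1, v, - c)) w) g a b
      = apply_stencil w (diff1 g) a b - apply_stencil w g a b"
    by (induction w) (auto simp: diff1_def algebra_simps)
  then show ?thesis by (simp add: diff1_stencil_def)
qed

lemma apply_diff2_stencil: "apply_stencil (diff2_stencil w) g a b = apply_stencil w (diff2 g) a b"
proof -
  have "apply_stencil (map (\<lambda>(u, v, c). (u, v + 1, - c)) w) g a b
      = apply_stencil w (diff2 g) a b - apply_stencil w g a b"
    by (induction w) (auto simp: diff2_def algebra_simps)
  then show ?thesis by (simp add: diff2_stencil_def)
qed

lemma diff1_diff2_commute: "diff1 (diff2 g) = diff2 (diff1 g)"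
  by (simp add: fun_eq_iff diff1_def diff2_def)

lemma apply_diff_stencil:
  "apply_stencil (diff_stencil (i, j, u, v)) g a b = (diff1 ^^ i) ((diff2 ^^ j) g) (a - u) (b - v)"
proof -
  have 2: "apply_stencil ((diff2_stencil ^^ j) [(u, v, 1)]) g a b = (diff2 ^^ j) g (a - u) (b - v)" for g
    by (induction j arbitrary: g) (simp_all add: apply_diff2_stencil funpow_swap1[of diff2])
  have 21: "(diff2 ^^ j) (diff1 g) = diff1 ((diff2 ^^ j) g)" for g :: "int \<Rightarrow> int \<Rightarrow> real"
    by (induction j) (simp_all add: diff1_diff2_commute)
  have "apply_stencil ((diff1_stencil ^^ i) ((diff2_stencil ^^ j) [(u, v, 1)])) g a b
      = (diff1 ^^ i) ((diff2 ^^ j) g) (a - u) (b - v)"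
    by (induction i arbitrary: g) (simp_all add: apply_diff1_stencil 2 21 funpow_swap1[of diff1])
  then show ?thesis by (simp add: diff_stencil_def)
qed

text \<open>Equality of two stencils as functionals is tested as the cancellation of their formal
  difference, which is integer arithmetic.\<close>

function cancels :: "stencil \<Rightarrow> bool" where
  "cancels [] \<longleftrightarrow> True"
| "cancels ((u, v, c) # w) \<longleftrightarrow>
     c + (\<Sum>(_, _, c')\<leftarrow>filter (\<lambda>(u', v', _). u' = u \<and> v' = v) w. c') = 0 \<and>
     cancels (filter (\<lambda>(u', v', _). \<not> (u' = u \<and> v' = v)) w)"
  by pat_completeness auto
termination by (relation "Wellfounded.measure length") (auto simp: le_imp_less_Suc)

lemma apply_stencil_filter_same:
  "apply_stencil (filter (\<lambda>(u', v', _). u' = u \<and> v' = v) w) g a b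
     = real_of_int (\<Sum>(_, _, c')\<leftarrow>filter (\<lambda>(u', v', _). u' = u \<and> v' = v) w. c') * g (a - u) (b - v)"
  by (induction w) (auto simp: algebra_simps)

lemma apply_stencil_filter_split:
  "apply_stencil w g a b
     = apply_stencil (filter P w) g a b + apply_stencil (filter (\<lambda>x. \<not> P x) w) g a b"
  by (induction w) auto

lemma apply_stencil_cancels: "cancels w \<Longrightarrow> apply_stencil w g a b = 0"
proof (induction w rule: cancels.induct)
  case (2 u v c w)
  let ?P = "\<lambda>(u', v', _). u' = u \<and> v' = v"
  have "apply_stencil (filter (\<lambda>x. \<not> ?P x) w) g a b = 0"
    using 2 by (simp add: case_prod_unfold)
  moreover have "real_of_int c + real_of_int (\<Sum>(_, _, c')\<leftarrow>filter ?P w. c') = 0"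
    using 2(2) by (simp flip: of_int_add)
  ultimately show ?case
    using apply_stencil_filter_split[of w g a b ?P] apply_stencil_filter_same[of u v w g a b]
    by (simp flip: distrib_right)
qed simp

(* The index (a, b) stands for the lattice point a e1 + b e2, and M(a, b) = (a - 2 b, a). *)
definition subdivision :: "nat \<Rightarrow> (int \<Rightarrow> int \<Rightarrow> real) \<Rightarrow> int \<Rightarrow> int \<Rightarrow> real" where
  "subdivision q g a b = (\<Sum>k\<le>q. if even (b - a + int k)
     then real (q choose k) / 2 ^ (q - 1) * g b ((b - a + int k) div 2) else 0)"

text \<open>The pullback of a stencil under subdivision at the points M(a, b) + d e1, cleared of the
  denominator \<open>2 ^ (q - 1)\<close>. Since det M = 2, the values 0 and 1 of \<open>d\<close>
  cover the whole lattice.\<close>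

definition transition :: "nat \<Rightarrow> int \<Rightarrow> stencil \<Rightarrow> stencil" where
  "transition q d w = concat (map (\<lambda>(u, v, c). concat (map (\<lambda>k.
     if even (v - u - int k + d) then [(v, (v - u - int k + d) div 2, c * int (q choose k))] else [])
     [0..<Suc q])) w)"

lemma apply_stencil_concat_map:
  "apply_stencil (concat (map f xs)) g a b = (\<Sum>x\<leftarrow>xs. apply_stencil (f x) g a b)"
  by (induction xs) auto

lemma apply_transition:
  "2 ^ (q - 1) * apply_stencil w (subdivision q g) (d + a - 2 * b) a
     = apply_stencil (transition q d w) g a b"
proof (induction w)
  case (Cons x w)
  obtain u v c where x: "x = (u, v, c)" by (cases x)
  have e: "a - v - (d + a - 2 * b - u) + int k = 2 * b - (v - u - int k + d)" for k
    by simp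
  have ev: "even (2 * b - t) \<longleftrightarrow> even t" for t :: int by presburger
  have "2 ^ (q - 1) * (real_of_int c * subdivision q g (d + a - 2 * b - u) (a - v))
      = (\<Sum>k\<le>q. if even (v - u - int k + d)
         then real_of_int c * real (q choose k) * g (a - v) ((2 * b - (v - u - int k + d)) div 2) else 0)"
    unfolding subdivision_def sum_distrib_left e ev by (intro sum.cong refl) auto
  also have "\<dots> = (\<Sum>k\<le>q. if even (v - u - int k + d)
         then real_of_int c * real (q choose k) * g (a - v) (b - (v - u - int k + d) div 2) else 0)"
  proof (intro sum.cong refl if_cong)
    fix k assume "even (v - u - int k + d)"
    then have "(2 * b - (v - u - int k + d)) div 2 = b - (v - u - int k + d) div 2"
      by presburger
    then show "real_of_int c * real (q choose k) * g (a - v) ((2 * b - (v - u - int k + d)) div 2)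
      = real_of_int c * real (q choose k) * g (a - v) (b - (v - u - int k + d) div 2)" by simp
  qed
  also have "\<dots> = (\<Sum>k\<leftarrow>[0..<Suc q]. if even (v - u - int k + d)
         then real_of_int c * real (q choose k) * g (a - v) (b - (v - u - int k + d) div 2) else 0)"
    by (subst interv_sum_list_conv_sum_set_nat)
       (simp add: atLeast0LessThan lessThan_Suc_atMost del: upt_Suc)
  also have "\<dots> = apply_stencil (concat (map (\<lambda>k.
     if even (v - u - int k + d) then [(v, (v - u - int k + d) div 2, c * int (q choose k))] else [])
     [0..<Suc q])) g a b"
    unfolding apply_stencil_concat_map
    by (intro arg_cong[where f=sum_list] map_cong refl) auto
  finally show ?case
    using Cons.IH by (simp add: x transition_def distrib_left del: upt_Suc)
qed (simp add: transition_def)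

definition scale_stencil :: "int \<Rightarrow> stencil \<Rightarrow> stencil" where
  "scale_stencil s w = (if s = 0 then [] else map (\<lambda>(u, v, c). (u, v, s * c)) w)"

lemma apply_scale_stencil: "apply_stencil (scale_stencil s w) g a b = s * apply_stencil w g a b"
proof -
  have "apply_stencil (map (\<lambda>(u, v, c). (u, v, s * c)) w) g a b = s * apply_stencil w g a b"
    by (induction w) (auto simp: algebra_simps)
  then show ?thesis by (simp add: scale_stencil_def)
qed

text \<open>Such a \<open>C\<close> can exist because the mask is (1 + z)^q, with z the shift by e1:
  each \<open>diff1\<close> absorbs a factor 1 + z and becomes a difference along 2 e1 = - M e2,
  while e1 + e2 = M e1 turns \<open>diff2\<close> into a coarse difference corrected by a
  \<open>diff1\<close>. Differences of order \<open>q\<close> thus come from differences of order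
  \<open>q\<close>, and the shifts in \<open>ps\<close> have to be chosen so that their span is
  closed under the transition. Column \<open>i\<close> of \<open>C\<close> holds the coefficients of
  the new difference \<open>i\<close>, so \<open>C\<close> acts transposed.\<close>

definition represents_transition ::
  "nat \<Rightarrow> int \<Rightarrow> (nat \<times> nat \<times> int \<times> int) list \<Rightarrow> int list list \<Rightarrow> bool" where
  "represents_transition q d ps C \<longleftrightarrow> mat_dim (length ps) C \<and> list_all (\<lambda>i.
     cancels (transition q d (diff_stencil (ps ! i)) @
       concat (map (\<lambda>(r, p). scale_stencil (- (r ! i)) (diff_stencil p)) (zip C ps))))
     [0..<length ps]"

text \<open>A step maps u to u' with 2^(q-1) u' = C^T u; clearing denominators, \<open>W0\<close>
  and \<open>W1\<close> say that the form \<open>Q\<close> shrinks at least by the factor 255 / 256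
  / 2^(q-1) for either residue. \<open>W2\<close> gives Q >= I, so that the form bounds every single
  difference, and the last condition provides each mixed difference of order \<open>q\<close> at
  some shift.\<close>

definition contraction_certificate ::
  "nat \<Rightarrow> (nat \<times> nat \<times> int \<times> int) list \<Rightarrow> int list list \<Rightarrow> int list list \<Rightarrow> int list list \<Rightarrow>
     int \<times> int list list \<Rightarrow> int \<times> int list list \<Rightarrow> int \<times> int list list \<Rightarrow> bool" where
  "contraction_certificate q ps C0 C1 Q W0 W1 W2 \<longleftrightarrow> (let n = length ps in
     mat_dim n Q \<and> represents_transition q 0 ps C0 \<and> represents_transition q 1 ps C1 \<and>
     psd_witness n (mat_diff (255 * 2 ^ (q - 1)) Q 256 (row_gram C0 (row_gram C0 Q))) W0 \<and>
     psd_witness n (mat_diff (255 * 2 ^ (q - 1)) Q 256 (row_gram C1 (row_gram C1 Q))) W1 \<and>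
     psd_witness n (mat_diff 1 Q 1 (mat_one n)) W2 \<and>
     list_all (\<lambda>i. list_ex (\<lambda>(i', j', _). i' = i \<and> j' = q - i) ps) [0..<Suc q])"

definition diff_vec ::
  "(nat \<times> nat \<times> int \<times> int) list \<Rightarrow> (int \<Rightarrow> int \<Rightarrow> real) \<Rightarrow> int \<Rightarrow> int \<Rightarrow> nat \<Rightarrow> real" where
  "diff_vec ps g a b i = apply_stencil (diff_stencil (ps ! i)) g a b"

lemma diff_vec_subdivision:
  assumes "represents_transition q d ps C" "i < length ps"
  shows "2 ^ (q - 1) * diff_vec ps (subdivision q g) (d + a - 2 * b) a i
       = (\<Sum>j<length ps. real_of_int (C ! j ! i) * diff_vec ps g a b j)"
proof -
  let ?L = "concat (map (\<lambda>(r, p). scale_stencil (- (r ! i)) (diff_stencil p)) (zip C ps))"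
  have len: "length C = length ps"
    using assms by (simp add: represents_transition_def mat_dim_def)
  have "cancels (transition q d (diff_stencil (ps ! i)) @ ?L)"
    using assms by (simp add: represents_transition_def list_all_iff)
  from apply_stencil_cancels[OF this, of g a b]
  have "2 ^ (q - 1) * diff_vec ps (subdivision q g) (d + a - 2 * b) a i = - apply_stencil ?L g a b"
    by (simp add: diff_vec_def apply_transition[unfolded One_nat_def])
  also have "apply_stencil ?L g a b
      = (\<Sum>x\<leftarrow>zip C ps. - (real_of_int (fst x ! i) * apply_stencil (diff_stencil (snd x)) g a b))"
    unfolding apply_stencil_concat_map by (simp add: case_prod_unfold apply_scale_stencil)
  also have "\<dots> = - (\<Sum>j<length ps. real_of_int (C ! j ! i) * diff_vec ps g a b j)"
    by (simp add: sum_list_sum_nth len atLeast0LessThan diff_vec_def sum_negf)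
  finally show ?thesis by simp
qed

lemma quad_form_scale: "quad_form n Q (\<lambda>i. c * u i) = c\<^sup>2 * quad_form n Q u"
  by (simp add: quad_form_def sum_distrib_left power2_eq_square mult_ac)

lemma quad_form_cong: "(\<And>i. i < n \<Longrightarrow> u i = v i) \<Longrightarrow> quad_form n Q u = quad_form n Q v"
  by (simp add: quad_form_def)

lemma quad_form_subdivision_step:
  assumes C: "represents_transition q d ps C" and Q: "mat_dim (length ps) Q"
    and W: "psd_witness (length ps)
      (mat_diff (255 * 2 ^ (q - 1)) Q 256 (row_gram C (row_gram C Q))) W"
  shows "quad_form (length ps) Q (diff_vec ps (subdivision q g) (d + a - 2 * b) a)
     \<le> 255 / 256 / 2 ^ (q - 1) * quad_form (length ps) Q (diff_vec ps g a b)"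
proof -
  let ?n = "length ps" and ?u = "diff_vec ps g a b"
  let ?u' = "diff_vec ps (subdivision q g) (d + a - 2 * b) a"
  have dim: "mat_dim ?n C" using C by (simp add: represents_transition_def)
  have "(2 ^ (q - 1))\<^sup>2 * quad_form ?n Q ?u' = quad_form ?n (row_gram C (row_gram C Q)) ?u"
    unfolding quad_form_congruence[OF Q dim] quad_form_scale[symmetric]
    by (intro quad_form_cong) (rule diff_vec_subdivision[OF C])
  moreover have "0 \<le> 255 * 2 ^ (q - 1) * quad_form ?n Q ?u
      - 256 * quad_form ?n (row_gram C (row_gram C Q)) ?u"
    using quad_form_psd_witness[OF W, of ?u] dim Q
    by (simp add: quad_form_mat_diff mat_dim_row_gram)
  ultimately have "256 * (2 ^ (q - 1) * (2 ^ (q - 1) * quad_form ?n Q ?u'))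
      \<le> 2 ^ (q - 1) * (255 * quad_form ?n Q ?u)"
    by (simp add: power2_eq_square mult_ac)
  then have "2 ^ (q - 1) * (256 * (2 ^ (q - 1) * quad_form ?n Q ?u'))
      \<le> 2 ^ (q - 1) * (255 * quad_form ?n Q ?u)"
    by (simp add: mult_ac)
  then have "256 * (2 ^ (q - 1) * quad_form ?n Q ?u') \<le> 255 * quad_form ?n Q ?u"
    by (subst (asm) mult_le_cancel_left_pos) auto
  then show ?thesis by (simp add: field_simps)
qed

section \<open>Decay along the iterates of the unit sequence\<close>

definition unit_seq :: "int \<Rightarrow> int \<Rightarrow> real" where
  "unit_seq a b = (if a = 0 \<and> b = 0 then 1 else 0)"

lemma apply_stencil_bounded:
  assumes "\<And>a b. \<bar>g a b\<bar> \<le> 1"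
  shows "\<bar>apply_stencil w g a b\<bar> \<le> (\<Sum>(u, v, c)\<leftarrow>w. \<bar>real_of_int c\<bar>)"
proof (induction w)
  case (Cons x w)
  obtain u v c where x: "x = (u, v, c)" by (cases x)
  have "\<bar>real_of_int c * g (a - u) (b - v)\<bar> \<le> \<bar>real_of_int c\<bar>"
    using assms[of "a - u" "b - v"] by (simp add: abs_mult mult_left_le)
  then show ?case using Cons.IH by (simp add: x)
qed simp

lemma quad_form_iterated_subdivision:
  assumes cert: "contraction_certificate q ps C0 C1 Q W0 W1 W2"
  shows "\<exists>B\<ge>0. \<forall>n a b. quad_form (length ps) Q (diff_vec ps ((subdivision q ^^ n) unit_seq) a b)
     \<le> B * (255 / 256 / 2 ^ (q - 1)) ^ n"
proof -
  let ?N = "length ps" and ?\<rho> = "255 / 256 / 2 ^ (q - 1) :: real"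
  have Q: "mat_dim ?N Q"
    and C: "represents_transition q 0 ps C0" "represents_transition q 1 ps C1"
    and W: "psd_witness ?N (mat_diff (255 * 2 ^ (q - 1)) Q 256 (row_gram C0 (row_gram C0 Q))) W0"
      "psd_witness ?N (mat_diff (255 * 2 ^ (q - 1)) Q 256 (row_gram C1 (row_gram C1 Q))) W1"
    using cert by (auto simp: contraction_certificate_def Let_def)
  define c where "c i = (\<Sum>(u, v, c)\<leftarrow>diff_stencil (ps ! i). \<bar>real_of_int c\<bar>)" for i
  define B where "B = (\<Sum>i<?N. \<Sum>j<?N. \<bar>real_of_int (Q ! i ! j)\<bar> * c i * c j)"
  have u0: "\<bar>diff_vec ps unit_seq a b i\<bar> \<le> c i" for a b i
    unfolding diff_vec_def c_def by (rule apply_stencil_bounded) (simp add: unit_seq_def)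
  then have c0: "0 \<le> c i" for i by (meson abs_ge_zero order_trans)
  have B0: "0 \<le> B" unfolding B_def by (intro sum_nonneg mult_nonneg_nonneg c0) auto
  have "quad_form ?N Q (diff_vec ps ((subdivision q ^^ n) unit_seq) a b) \<le> B * ?\<rho> ^ n" for n a b
  proof (induction n arbitrary: a b)
    case 0
    have "quad_form ?N Q (diff_vec ps unit_seq a b) \<le> B"
      unfolding quad_form_def B_def
    proof (intro sum_mono)
      fix i j
      let ?t = "real_of_int (Q ! i ! j) * diff_vec ps unit_seq a b i * diff_vec ps unit_seq a b j"
      have "?t \<le> \<bar>?t\<bar>" by simp
      also have "\<bar>?t\<bar> \<le> \<bar>real_of_int (Q ! i ! j)\<bar> * c i * c j"
        unfolding abs_mult using u0 c0 by (intro mult_mono mult_nonneg_nonneg) auto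
      finally show "?t \<le> \<bar>real_of_int (Q ! i ! j)\<bar> * c i * c j" .
    qed
    then show ?case by simp
  next
    case (Suc n)
    define g where "g = (subdivision q ^^ n) unit_seq"
    \<comment> \<open>The parity of \<open>a - b\<close> decides which of the two transition
      matrices acts at this point.\<close>
    obtain d a' b' where d: "d = 0 \<or> d = 1" and a: "a = d + a' - 2 * b'" and b: "b = a'"
    proof
      show "(a - b) mod 2 = 0 \<or> (a - b) mod 2 = 1" by presburger
      show "a = (a - b) mod 2 + b - 2 * (- ((a - b) div 2))"
        using mod_mult_div_eq[of "a - b" 2] by simp
    qed simp
    have "quad_form ?N Q (diff_vec ps (subdivision q g) a b) \<le> ?\<rho> * quad_form ?N Q (diff_vec ps g a' b')"
      using d quad_form_subdivision_step[OF C(1) Q W(1), of g a' b']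
        quad_form_subdivision_step[OF C(2) Q W(2), of g a' b'] unfolding a b by auto
    also have "\<dots> \<le> ?\<rho> * (B * ?\<rho> ^ n)"
      using Suc.IH by (intro mult_left_mono) (auto simp: g_def)
    finally show ?case by (simp add: g_def mult_ac)
  qed
  then show ?thesis using B0 by blast
qed

text \<open>The form dominates the square of each listed difference, hence the square root in the
  rate.\<close>

lemma diff_iterated_subdivision_bound:
  assumes cert: "contraction_certificate q ps C0 C1 Q W0 W1 W2" and ij: "i + j = q"
  shows "\<exists>B. \<forall>n a b. \<bar>(diff1 ^^ i) ((diff2 ^^ j) ((subdivision q ^^ n) unit_seq)) a b\<bar>
     \<le> B * sqrt (255 / 256 / 2 ^ (q - 1)) ^ n"
proof -
  let ?N = "length ps" and ?\<rho> = "255 / 256 / 2 ^ (q - 1) :: real"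
  obtain B where B: "\<And>n a b. quad_form ?N Q (diff_vec ps ((subdivision q ^^ n) unit_seq) a b)
     \<le> B * ?\<rho> ^ n" and "B \<ge> 0"
    using quad_form_iterated_subdivision[OF cert] by blast
  have "i < Suc q" "j = q - i" using ij by auto
  then obtain u v where "(i, j, u, v) \<in> set ps"
    using cert by (fastforce simp: contraction_certificate_def Let_def list_all_iff list_ex_iff
        simp del: upt_Suc)
  then obtain m where m: "m < ?N" "ps ! m = (i, j, u, v)" by (auto simp: in_set_conv_nth)
  have Q: "mat_dim ?N Q" "psd_witness ?N (mat_diff 1 Q 1 (mat_one ?N)) W2"
    using cert by (auto simp: contraction_certificate_def Let_def)
  have "\<bar>(diff1 ^^ i) ((diff2 ^^ j) ((subdivision q ^^ n) unit_seq)) a b\<bar> \<le> sqrt B * sqrt ?\<rho> ^ n" for n a b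
  proof -
    \<comment> \<open>The translation by \<open>(u, v)\<close> undoes the offset of the stencil
      found in \<open>ps\<close>.\<close>
    define x where "x = diff_vec ps ((subdivision q ^^ n) unit_seq) (a + u) (b + v)"
    have "(x m)\<^sup>2 \<le> (\<Sum>i<?N. (x i)\<^sup>2)" using m by (intro member_le_sum) auto
    also have "\<dots> \<le> quad_form ?N Q x"
      using quad_form_psd_witness[OF Q(2), of x] Q(1)
      by (simp add: quad_form_mat_diff mat_dim_mat_one quad_form_mat_one)
    also have "\<dots> \<le> B * ?\<rho> ^ n" unfolding x_def by (rule B)
    finally have "sqrt ((x m)\<^sup>2) \<le> sqrt (B * ?\<rho> ^ n)" by (rule real_sqrt_le_mono)
    then have "\<bar>x m\<bar> \<le> sqrt B * sqrt ?\<rho> ^ n"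
      unfolding real_sqrt_abs by (simp only: real_sqrt_mult real_sqrt_power)
    then show ?thesis
      by (simp add: x_def diff_vec_def m apply_diff_stencil)
  qed
  then show ?thesis by blast
qed

section \<open>Numerical certificates\<close>

text \<open>
  The forms are rounded solutions of the semidefinite program that asks for a common Lyapunov form,
  and the triangular matrices are rounded Cholesky factors, whose rounding error is absorbed by the
  diagonal dominance of the remainder.
\<close>

definition basis3 :: "(nat \<times> nat \<times> int \<times> int) list" where
  "basis3 = [(3, 0, -2, -1), (3, 0, -2, 0), (2, 1, -2, -2), (2, 1, -2, -1), (2, 1, -1, 0), (1, 2, -2, -2), (1, 2, -1, -1), (0, 3, -1, -2)]"

definition trans0_3 :: "int list list" where
  "trans0_3 = [
     [0, 0, 0, 0, 1, 0, 1, 0],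
     [0, 0, 0, 0, -1, 0, -1, 4],
     [0, -1, 0, 0, 1, 0, 0, 0],
     [0, 1, 0, 0, -2, -2, -1, 5],
     [0, 0, 0, 0, 1, 0, -1, 1],
     [0, 1, 1, 0, -1, -1, 0, 1],
     [0, -1, 0, 1, 2, -1, -2, 2],
     [0, -1, 0, 1, 1, -1, -1, 1]]"

definition trans1_3 :: "int list list" where
  "trans1_3 = [
     [0, 0, 0, 0, 1, 0, 0, 0],
     [0, 0, 0, 0, -1, 0, 0, 4],
     [0, 0, 0, 0, 0, 0, 0, 0],
     [0, 0, 0, 0, -1, -2, 0, 3],
     [0, 0, 0, 0, 1, 0, -2, 3],
     [0, 0, 1, 0, 0, 0, 0, 0],
     [0, 0, 0, 1, 1, -2, -2, 3],
     [-1, 0, 1, 0, 0, 0, 0, 0]]"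

definition form3 :: "int list list" where
  "form3 = [
     [356, -145, 50, -88, 33, 58, 31, -29],
     [-145, 771, -85, 732, 176, 198, 256, 73],
     [50, -85, 210, -146, 10, -98, 87, 60],
     [-88, 732, -146, 1241, 8, 447, 146, 93],
     [33, 176, 10, 8, 339, -73, 271, 33],
     [58, 198, -98, 447, -73, 324, -92, -13],
     [31, 256, 87, 146, 271, -92, 458, 130],
     [-29, 73, 60, 93, 33, -13, 130, 152]]"

definition witness0_3 :: "int \<times> int list list" where
  "witness0_3 = (1, [
     [135, 0, 0, 0, 0, 0, 0, 0],
     [207, 332, 0, 0, 0, 0, 0, 0],
     [40, -25, 126, 0, 0, 0, 0, 0],
     [40, -108, -10, 113, 0, 0, 0, 0],
     [165, 302, -130, 39, 390, 0, 0, 0],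
     [-30, 0, 94, -111, -86, 94, 0, 0],
     [281, 152, -82, 205, 174, -21, 123, 0],
     [-88, -46, -3, -73, 54, -3, -13, 84]])"

definition witness1_3 :: "int \<times> int list list" where
  "witness1_3 = (1, [
     [524, 0, 0, 0, 0, 0, 0, 0],
     [-181, 331, 0, 0, 0, 0, 0, 0],
     [97, -208, 399, 0, 0, 0, 0, 0],
     [-125, 724, 36, 197, 0, 0, 0, 0],
     [115, -183, -98, -34, 80, 0, 0, 0],
     [108, 491, -21, 107, 8, 102, 0, 0],
     [36, -229, 94, -23, -37, 24, 70, 0],
     [-45, -93, 116, -9, -11, -3, 39, 89]])"

definition witness2_3 :: "int \<times> int list list" where
  "witness2_3 = (4, [
     [36, 0, 0, 0, 0, 0, 0, 0],
     [-16, 52, 0, 0, 0, 0, 0, 0],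
     [6, -5, 26, 0, 0, 0, 0, 0],
     [-10, 53, -11, 42, 0, 0, 0, 0],
     [4, 15, 4, -16, 27, 0, 0, 0],
     [6, 17, -13, 19, -8, 15, 0, 0],
     [3, 21, 17, -7, 22, -14, 16, 0],
     [-3, 5, 11, 5, 4, -1, 11, 13]])"

lemma certificate3:
  "contraction_certificate 3 basis3 trans0_3 trans1_3 form3 witness0_3 witness1_3 witness2_3"
  by code_simp

section \<open>Certificate for q = 4, the number of convolution factors of Bear-4\<close>

definition basis4 :: "(nat \<times> nat \<times> int \<times> int) list" where
  "basis4 = [(4, 0, -3, -2), (4, 0, -3, -1), (4, 0, -3, 0), (4, 0, -2, -1), (4, 0, -2, 0), (4, 0, -2, 1), (3, 1, -3, -3), (3, 1, -3, -2), (3, 1, -3, -1), (3, 1, -2, 0), (2, 2, -3, -3), (2, 2, -3, -2), (2, 2, -2, -1), (1, 3, -3, -3), (1, 3, -2, -2), (1, 3, 0, -1), (0, 4, -2, -3), (0, 4, 0, -2)]"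

definition trans0_4 :: "int list list" where
  "trans0_4 = [
     [0, 0, 0, 0, 0, 0, 0, 0, 0, 1, 0, 0, 0, 0, 0, -3, 0, 0],
     [0, 0, 0, 0, 0, 0, 0, 0, 0, -3, 0, 0, 2, 0, 1, 6, 0, -12],
     [0, 0, 0, 0, 0, 0, 0, 0, 0, 2, 0, 0, -2, 0, -1, -3, 8, 12],
     [0, 0, 0, 0, 0, 0, 0, 0, 0, 0, 0, 0, 0, 0, 0, 3, 0, 1],
     [0, 0, 0, 0, 0, 0, 0, 0, 0, 0, 0, 0, 0, 0, 0, -2, 0, 6],
     [0, 0, 0, 0, 0, 0, 0, 0, 0, 0, 0, 0, 0, 0, 0, -1, 0, 1],
     [0, 0, 0, 0, -1, 0, 0, 0, 0, 0, 0, 0, 0, 0, 0, 0, 0, 0],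
     [0, 0, 0, 0, 3, 0, 0, 0, -1, -3, 0, 0, 2, 0, 0, 3, 0, -6],
     [0, 0, 0, 0, -2, 0, 0, 0, 1, 4, 0, 0, -4, -4, -1, -3, 12, 18],
     [0, 0, 0, 0, 0, 0, 0, 0, 0, -1, 0, 0, 2, 0, -3, -4, 4, 4],
     [0, 1, 0, 0, 3, 0, 0, 0, 0, 0, 0, 0, 0, 0, 0, -1, 0, 0],
     [0, -1, 0, 0, -4, 0, 0, 0, 1, 2, 2, 0, -2, -3, 0, 1, 4, 6],
     [0, 0, 0, 0, 1, 0, 0, 0, -1, -2, 0, 2, 4, -3, -6, -6, 8, 6],
     [0, -1, 0, 0, -2, 0, -1, 0, 0, 0, 1, 0, 0, 0, 0, 1, 0, 0],
     [0, 1, 0, 0, 2, 0, 0, -1, -1, -1, 1, 2, 2, -3, -3, -4, 4, 4],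
     [0, 0, 0, 0, 0, 0, 0, 0, 0, 0, 0, 0, 0, 0, 0, 0, 0, 0],
     [0, 1, 0, 0, 1, 0, 0, -1, 0, 0, 1, 0, 0, 0, 0, -1, 0, 1],
     [0, 0, 0, 0, 0, 0, 0, 0, 0, 0, 0, 0, 0, 0, 0, 0, 0, 0]]"

definition trans1_4 :: "int list list" where
  "trans1_4 = [
     [0, 0, 0, 0, 0, 1, 0, 0, 0, 0, 0, 0, 0, 0, 0, 0, 0, 0],
     [0, 0, 0, 0, 0, -3, 0, 0, 0, 0, 0, 0, 2, 0, -1, -5, 1, -4],
     [0, 0, 0, 0, 0, 2, 0, 0, 0, 0, 0, 0, -2, 0, 1, 5, 7, 4],
     [0, 0, 0, 0, 0, 0, 0, 0, 0, 0, 0, 0, 0, 0, 0, 1, 0, 0],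
     [0, 0, 0, 0, 0, 0, 0, 0, 0, 0, 0, 0, 0, 0, 0, 2, 0, 4],
     [0, 0, 0, 0, 0, 0, 0, 0, 0, 0, 0, 0, 0, 0, 0, -3, 0, 4],
     [0, 0, 0, 0, 0, 0, 0, 0, 0, 0, 0, 0, 0, 0, 0, 0, 0, 0],
     [0, 0, 0, 0, 0, -3, 0, 0, -1, 0, 0, 1, 1, -1, -1, -3, 1, 0],
     [0, 0, 0, 0, 0, 4, 0, 0, 1, 0, 0, -1, -3, -3, 2, 8, 6, 4],
     [0, 0, 0, 0, 0, -1, 0, 0, 0, 0, 0, 0, 2, 0, -5, -9, 9, 12],
     [0, 0, 0, 1, 0, 0, 0, 0, 0, 0, 0, 0, 0, 0, 0, 0, 0, 0],
     [0, 0, 0, -1, 0, 2, 0, 0, 1, 0, 2, -1, -1, 0, 1, 3, 0, 0],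
     [0, 0, 0, 0, 0, -2, 0, 0, -1, 0, 0, 3, 3, -6, -7, -9, 12, 12],
     [0, 0, 0, -1, 0, 0, -1, 0, 0, 0, 0, 0, 0, 0, 0, 0, 0, 0],
     [0, 0, 0, 1, 0, -1, 0, -1, -1, 0, 2, 2, 1, -3, -2, -3, 3, 4],
     [0, 0, 0, 0, 0, 1, 0, 0, 0, -1, 0, 0, 1, 0, -1, 0, 1, 0],
     [1, 0, 0, 1, 0, 0, -1, 0, 0, 0, 0, 0, 0, 0, 0, 0, 0, 0],
     [0, 0, 1, 0, 0, 1, 0, 0, -1, -1, 0, 1, 1, -1, -1, 0, 1, 0]]"

definition form4 :: "int list list" where
  "form4 = [
     [182, -49, 4, -90, 4, 5, -6, -41, -46, 66, 60, -85, 86, -47, 49, 13, -1, 10],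
     [-49, 912, -435, -83, -280, -12, -6, 400, -494, 28, -44, 31, 5, 101, -113, 19, -46, 26],
     [4, -435, 941, -29, 121, -1, 4, -246, 1216, 179, 39, 350, 400, -29, 284, 12, 66, -5],
     [-90, -83, -29, 245, 44, -41, -7, -26, 81, -94, -20, 121, -117, 29, -9, -34, 22, -18],
     [4, -280, 121, 44, 236, 49, -7, -98, 190, 130, 19, 43, 150, -16, 86, -1, 26, 2],
     [5, -12, -1, -41, 49, 100, -5, 1, -28, 215, 3, -49, 212, -10, 71, 6, 11, -3],
     [-6, -6, 4, -7, -7, -5, 48, -66, 3, -8, -59, 38, -44, 15, -34, -3, -12, -3],
     [-41, 400, -246, -26, -98, 1, -66, 602, -497, 77, 108, -295, 184, 5, 67, 4, -16, 24],
     [-46, -494, 1216, 81, 190, -28, 3, -497, 2333, -51, -58, 1199, 197, 121, 324, -12, 121, -20],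
     [66, 28, 179, -94, 130, 215, -8, 77, -51, 1009, 46, -226, 1137, -49, 385, 51, 32, 40],
     [60, -44, 39, -20, 19, 3, -59, 108, -58, 46, 191, -217, 143, -113, 148, 5, 53, -1],
     [-85, 31, 350, 121, 43, -49, 38, -295, 1199, -226, -217, 1120, -312, 280, -98, -17, 24, -19],
     [86, 5, 400, -117, 150, 212, -44, 184, 197, 1137, 143, -312, 1679, -129, 743, 54, 82, 78],
     [-47, 101, -29, 29, -16, -10, 15, 5, 121, -49, -113, 280, -129, 155, -128, 2, -34, 2],
     [49, -113, 284, -9, 86, 71, -34, 67, 324, 385, 148, -98, 743, -128, 560, -7, 131, 15],
     [13, 19, 12, -34, -1, 6, -3, 4, -12, 51, 5, -17, 54, 2, -7, 36, -11, 19],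
     [-1, -46, 66, 22, 26, 11, -12, -16, 121, 32, 53, 24, 82, -34, 131, -11, 86, -14],
     [10, 26, -5, -18, 2, -3, -3, 24, -20, 40, -1, -19, 78, 2, 15, 19, -14, 43]]"

definition witness0_4 :: "int \<times> int list list" where
  "witness0_4 = (2, [
     [459, 0, 0, 0, 0, 0, 0, 0, 0, 0, 0, 0, 0, 0, 0, 0, 0, 0],
     [-45, 706, 0, 0, 0, 0, 0, 0, 0, 0, 0, 0, 0, 0, 0, 0, 0, 0],
     [211, 53, 764, 0, 0, 0, 0, 0, 0, 0, 0, 0, 0, 0, 0, 0, 0, 0],
     [-590, -124, -222, 579, 0, 0, 0, 0, 0, 0, 0, 0, 0, 0, 0, 0, 0, 0],
     [22, -182, -332, -139, 401, 0, 0, 0, 0, 0, 0, 0, 0, 0, 0, 0, 0, 0],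
     [0, 139, -164, -298, 95, 487, 0, 0, 0, 0, 0, 0, 0, 0, 0, 0, 0, 0],
     [95, -53, 72, 63, -1, 39, 216, 0, 0, 0, 0, 0, 0, 0, 0, 0, 0, 0],
     [-60, 455, -207, 8, 2, -85, -47, 327, 0, 0, 0, 0, 0, 0, 0, 0, 0, 0],
     [-76, -284, 271, 17, -441, -251, -110, -84, 300, 0, 0, 0, 0, 0, 0, 0, 0, 0],
     [256, 1087, -212, -258, 600, 993, 39, 189, -590, 550, 0, 0, 0, 0, 0, 0, 0, 0],
     [57, 56, -39, -44, 17, -69, -70, 35, 39, 46, 229, 0, 0, 0, 0, 0, 0, 0],
     [-278, -407, -40, 190, -138, -171, -14, -115, 8, -134, 32, 190, 0, 0, 0, 0, 0, 0],
     [234, 1558, -206, -299, 622, 733, 21, 279, -263, 345, -201, -112, 519, 0, 0, 0, 0, 0],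
     [-123, -9, -14, 8, -31, -37, -52, 5, -6, 35, -3, 74, -46, 207, 0, 0, 0, 0],
     [69, 388, -205, 46, 77, 285, 93, 95, -56, -29, -104, -260, 204, -38, 181, 0, 0, 0],
     [115, 117, 24, -88, 26, -34, -55, -91, -75, 48, 7, 112, 4, 56, -129, 228, 0, 0],
     [-132, -51, 13, -14, 53, 66, -13, 69, 36, 36, 36, 24, -46, -48, 92, -26, 169, 0],
     [89, 156, -62, -27, 26, -112, -8, 30, -95, -27, -115, 9, 103, 97, -122, 80, -13, 232]])"

definition witness1_4 :: "int \<times> int list list" where
  "witness1_4 = (1, [
     [583, 0, 0, 0, 0, 0, 0, 0, 0, 0, 0, 0, 0, 0, 0, 0, 0, 0],
     [-192, 951, 0, 0, 0, 0, 0, 0, 0, 0, 0, 0, 0, 0, 0, 0, 0, 0],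
     [39, -376, 501, 0, 0, 0, 0, 0, 0, 0, 0, 0, 0, 0, 0, 0, 0, 0],
     [-317, -196, -279, 518, 0, 0, 0, 0, 0, 0, 0, 0, 0, 0, 0, 0, 0, 0],
     [14, -365, 95, 22, 205, 0, 0, 0, 0, 0, 0, 0, 0, 0, 0, 0, 0, 0],
     [31, -16, 53, -104, -51, 197, 0, 0, 0, 0, 0, 0, 0, 0, 0, 0, 0, 0],
     [-21, -17, 5, -44, -96, -99, 266, 0, 0, 0, 0, 0, 0, 0, 0, 0, 0, 0],
     [-66, 637, -109, 81, 413, -73, -333, 328, 0, 0, 0, 0, 0, 0, 0, 0, 0, 0],
     [-187, -491, 898, 431, 119, 193, 146, -257, 475, 0, 0, 0, 0, 0, 0, 0, 0, 0],
     [240, -39, 120, -145, -201, 224, -60, -40, -46, 231, 0, 0, 0, 0, 0, 0, 0, 0],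
     [228, -92, 44, 66, 157, 13, -369, 209, -124, 57, 179, 0, 0, 0, 0, 0, 0, 0],
     [-361, 77, 532, 518, 4, 92, 379, -361, 525, -51, -150, 261, 0, 0, 0, 0, 0, 0],
     [335, -150, 146, -194, 40, 320, -222, 114, -43, 179, 62, -134, 210, 0, 0, 0, 0, 0],
     [-185, 217, 53, 93, 8, 15, 137, -166, 178, -16, -52, 207, -53, 141, 0, 0, 0, 0],
     [217, -291, 157, 100, 106, 195, -137, 187, -8, 163, 30, -206, 193, 44, 144, 0, 0, 0],
     [29, 35, 48, -79, -5, -8, -37, 5, -29, -15, 10, 14, -39, -1, -28, 111, 0, 0],
     [10, -147, 103, 101, 7, 84, -52, 63, 17, 88, 13, -58, 73, 47, 9, -3, 112, 0],
     [24, 26, -2, -52, 45, -9, -15, -3, -3, -24, 2, 4, -3, -22, 19, 8, 12, 101]])"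

definition witness2_4 :: "int \<times> int list list" where
  "witness2_4 = (256, [
     [210, 0, 0, 0, 0, 0, 0, 0, 0, 0, 0, 0, 0, 0, 0, 0, 0, 0],
     [-60, 477, 0, 0, 0, 0, 0, 0, 0, 0, 0, 0, 0, 0, 0, 0, 0, 0],
     [5, -233, 429, 0, 0, 0, 0, 0, 0, 0, 0, 0, 0, 0, 0, 0, 0, 0],
     [-110, -58, -48, 206, 0, 0, 0, 0, 0, 0, 0, 0, 0, 0, 0, 0, 0, 0],
     [5, -150, -9, 13, 188, 0, 0, 0, 0, 0, 0, 0, 0, 0, 0, 0, 0, 0],
     [6, -6, -4, -50, 65, 127, 0, 0, 0, 0, 0, 0, 0, 0, 0, 0, 0, 0],
     [-7, -4, 0, -14, -12, -9, 96, 0, 0, 0, 0, 0, 0, 0, 0, 0, 0, 0],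
     [-50, 208, -33, -8, 33, -7, -168, 274, 0, 0, 0, 0, 0, 0, 0, 0, 0, 0],
     [-56, -272, 578, 128, 63, -31, 14, -194, 352, 0, 0, 0, 0, 0, 0, 0, 0, 0],
     [80, 25, 120, -39, 204, 313, 35, 86, -150, 249, 0, 0, 0, 0, 0, 0, 0, 0],
     [73, -14, 15, 13, 12, 1, -148, 35, -48, -11, 121, 0, 0, 0, 0, 0, 0, 0],
     [-104, 4, 212, 145, 65, -63, 115, -206, 322, -3, -116, 162, 0, 0, 0, 0, 0, 0],
     [105, 16, 246, -28, 228, 301, -56, 154, -149, 310, 45, -127, 220, 0, 0, 0, 0, 0],
     [-57, 47, 9, 21, 16, -15, 41, -17, 78, 15, -116, 73, -10, 58, 0, 0, 0, 0],
     [60, -53, 140, 38, 78, 117, -62, 87, 7, 93, 150, -68, 174, -37, 120, 0, 0, 0],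
     [16, 12, 14, -27, 10, -4, -9, -9, -16, 26, -10, 4, -9, 10, -14, 60, 0, 0],
     [-1, -25, 26, 26, 15, 24, -25, -9, 12, -1, 78, 23, 30, -9, 59, -7, 69, 0],
     [12, 15, 5, -10, 16, -18, -8, 6, -6, 36, -19, -21, 15, -1, -9, 46, -8, 52]])"

lemma certificate4:
  "contraction_certificate 4 basis4 trans0_4 trans1_4 form4 witness0_4 witness1_4 witness2_4"
  by code_simp

section \<open>Smoothness from decaying differences\<close>

lemma times_cont_differentiable_bounded_linear:
  assumes L: "bounded_linear L" and f: "times_cont_differentiable k f"
  shows "times_cont_differentiable k (\<lambda>x. L (f x))"
  using f
proof (induction k arbitrary: f)
  case 0
  then show ?case using bounded_linear.continuous_on[OF L] by simp
next
  case (Suc k)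
  have d: "((\<lambda>x. L (f x)) has_derivative (\<lambda>v. L (frechet_derivative f (at x) v))) (at x)" for x
    using Suc.prems by (intro bounded_linear.has_derivative[OF L]) (simp add: frechet_derivative_works)
  then have "(\<lambda>x. L (f x)) differentiable (at x)" for x by (auto simp: differentiable_def)
  moreover have "frechet_derivative (\<lambda>x. L (f x)) (at x) = (\<lambda>v. L (frechet_derivative f (at x) v))" for x
    using d by (rule frechet_derivative_at[symmetric])
  ultimately show ?case using Suc by simp
qed

lemma times_cont_differentiable_compose_linear:
  assumes L: "bounded_linear L" and f: "times_cont_differentiable k f"
  shows "times_cont_differentiable k (\<lambda>x. f (L x))"
  using f
proof (induction k arbitrary: f)
  case 0
  then have "continuous_on (range L) f" by (auto intro: continuous_on_subset)
  then show ?case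
    using continuous_on_compose2[OF _ bounded_linear.continuous_on[OF L continuous_on_id], of "range L" f UNIV]
    by simp
next
  case (Suc k)
  have d: "((\<lambda>x. f (L x)) has_derivative (\<lambda>v. frechet_derivative f (at (L x)) (L v))) (at x)" for x
  proof -
    have "(f has_derivative frechet_derivative f (at (L x))) (at (L x))"
      using Suc.prems by (simp flip: frechet_derivative_works)
    from diff_chain_at[OF bounded_linear_imp_has_derivative[OF L] this] show ?thesis
      by (simp add: o_def)
  qed
  then have "(\<lambda>x. f (L x)) differentiable (at x)" for x by (auto simp: differentiable_def)
  moreover have "frechet_derivative (\<lambda>x. f (L x)) (at x) = (\<lambda>v. frechet_derivative f (at (L x)) (L v))" for x
    using d by (rule frechet_derivative_at[symmetric])
  moreover have "times_cont_differentiable k (\<lambda>x. frechet_derivative f (at (L x)) (L v))" for v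
    using Suc.IH[of "\<lambda>x. frechet_derivative f (at x) (L v)"] Suc.prems by simp
  ultimately show ?case by simp
qed

lemma times_cont_differentiable_add:
  assumes "times_cont_differentiable k f" "times_cont_differentiable k g"
  shows "times_cont_differentiable k (\<lambda>x. f x + g x)"
  using assms
proof (induction k arbitrary: f g)
  case 0
  then show ?case by (simp add: continuous_on_add)
next
  case (Suc k)
  have d: "((\<lambda>x. f x + g x) has_derivative
      (\<lambda>v. frechet_derivative f (at x) v + frechet_derivative g (at x) v)) (at x)" for x
    using Suc.prems by (intro has_derivative_add) (simp_all add: frechet_derivative_works)
  then have "(\<lambda>x. f x + g x) differentiable (at x)" for x by (auto simp: differentiable_def)
  moreover have "frechet_derivative (\<lambda>x. f x + g x) (at x)
      = (\<lambda>v. frechet_derivative f (at x) v + frechet_derivative g (at x) v)" for x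
    using d by (rule frechet_derivative_at[symmetric])
  ultimately show ?case using Suc by simp
qed

(* An eigenvalue of the dilation matrix; the lattice vectors e1, e2 become 1 and eig - 1. *)
definition eig :: complex where
  "eig = Complex (1 / 2) (sqrt 7 / 2)"

text \<open>This is the characteristic equation of M, whose trace is 1 and whose determinant is
  2.\<close>

lemma eig_square: "eig * eig = eig - 2"
  by (simp add: eig_def complex_eq_iff field_simps)

lemma eig_nonzero [simp]: "eig \<noteq> 0"
  by (simp add: eig_def complex_eq_iff)

lemma cnj_eig: "cnj eig = 1 - eig"
  by (simp add: eig_def complex_eq_iff)

lemma norm_eig [simp]: "norm eig = sqrt 2"
  by (simp add: eig_def cmod_def power2_eq_square)

lemma eig_gap: "eig - cnj eig \<noteq> 0"
  by (simp add: eig_def complex_eq_iff)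

definition mult_of :: "bool \<Rightarrow> complex" where
  "mult_of b = (if b then eig else cnj eig)"

lemma mult_of_square: "mult_of b * mult_of b = mult_of b - 2"
  using eig_square by (auto simp: mult_of_def cnj_eig algebra_simps)

lemma norm_mult_of [simp]: "norm (mult_of b) = sqrt 2"
  by (simp add: mult_of_def)

section \<open>Eigen-differences as discrete Wirtinger derivatives\<close>

definition step1 :: "complex \<Rightarrow> (complex \<Rightarrow> complex) \<Rightarrow> complex \<Rightarrow> complex" where
  "step1 h f z = f z - f (z - h)"

definition step2 :: "complex \<Rightarrow> (complex \<Rightarrow> complex) \<Rightarrow> complex \<Rightarrow> complex" where
  "step2 h f z = f z - f (z - (eig - 1) * h)"

text \<open>Multiplying the step by \<open>eig\<close> maps the pair (s1, s2) of first differences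
  to (s1 + s2, - 2 s1) modulo second differences, and (mu, 1) is a left eigenvector of this map
  exactly if mu^2 = mu - 2. On a real-linear map A u + B cnj u the choice \<open>True\<close> yields
  (eig - cnj eig) A h and \<open>False\<close> yields - (eig - cnj eig) B cnj h.\<close>

definition eig_diff :: "bool \<Rightarrow> complex \<Rightarrow> (complex \<Rightarrow> complex) \<Rightarrow> complex \<Rightarrow> complex" where
  "eig_diff b h f z = mult_of b * step1 h f z + step2 h f z"

primrec eig_diffs :: "bool list \<Rightarrow> complex \<Rightarrow> (complex \<Rightarrow> complex) \<Rightarrow> complex \<Rightarrow> complex" where
  "eig_diffs [] h f = f"
| "eig_diffs (b # bs) h f = eig_diff b h (eig_diffs bs h f)"

lemma step1_eq: "step1 h f z = (eig_diff True h f z - eig_diff False h f z) / (eig - cnj eig)"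
  using eig_gap by (simp add: eig_diff_def mult_of_def field_simps)

lemma step2_eq: "step2 h f z = eig_diff True h f z - eig * step1 h f z"
  by (simp add: eig_diff_def mult_of_def)

lemma eig_diff_add: "eig_diff b h (\<lambda>z. f z + g z) z = eig_diff b h f z + eig_diff b h g z"
  by (simp add: eig_diff_def step1_def step2_def algebra_simps)

lemma eig_diff_mult: "eig_diff b h (\<lambda>z. c * f z) z = c * eig_diff b h f z"
  by (simp add: eig_diff_def step1_def step2_def algebra_simps)

lemma eig_diff_shift: "eig_diff b h (\<lambda>z. f (z - c)) z = eig_diff b h f (z - c)"
  by (simp add: eig_diff_def step1_def step2_def algebra_simps)

lemma eig_diffs_add: "eig_diffs ws h (\<lambda>z. f z + g z) z = eig_diffs ws h f z + eig_diffs ws h g z"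
proof (induction ws arbitrary: z)
  case (Cons b ws)
  then have "eig_diffs ws h (\<lambda>z. f z + g z) = (\<lambda>z. eig_diffs ws h f z + eig_diffs ws h g z)" by blast
  then show ?case by (simp add: eig_diff_add)
qed simp

lemma eig_diffs_mult: "eig_diffs ws h (\<lambda>z. c * f z) z = c * eig_diffs ws h f z"
proof (induction ws arbitrary: z)
  case (Cons b ws)
  then have "eig_diffs ws h (\<lambda>z. c * f z) = (\<lambda>z. c * eig_diffs ws h f z)" by blast
  then show ?case by (simp add: eig_diff_mult)
qed simp

lemma eig_diffs_shift: "eig_diffs ws h (\<lambda>z. f (z - c)) z = eig_diffs ws h f (z - c)"
proof (induction ws arbitrary: z)
  case (Cons b ws)
  then have "eig_diffs ws h (\<lambda>z. f (z - c)) = (\<lambda>z. eig_diffs ws h f (z - c))" by blast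
  then show ?case by (simp add: eig_diff_shift)
qed simp

lemma eig_diffs_snoc: "eig_diffs (ws @ [b]) h f = eig_diffs ws h (eig_diff b h f)"
  by (induction ws) auto

lemma continuous_on_eig_diffs:
  "continuous_on UNIV f \<Longrightarrow> continuous_on UNIV (eig_diffs ws h f)"
proof (induction ws)
  case (Cons b ws)
  then have c: "continuous_on UNIV (eig_diffs ws h f)" by simp
  have "continuous_on UNIV (\<lambda>z. eig_diffs ws h f (z - c))" for c
    by (rule continuous_on_compose2[OF c]) (auto intro: continuous_on_diff continuous_on_id)
  then show ?case
    unfolding eig_diffs.simps eig_diff_def[abs_def] step1_def step2_def
    by (intro continuous_on_add continuous_on_diff continuous_on_mult continuous_on_const c)
qed simp

(* Families are indexed by the step h, so that a bound on the k-th order differences of f at all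
   scales yields one on every member with a single constant. *)
inductive diff_family :: "(complex \<Rightarrow> complex) \<Rightarrow> nat \<Rightarrow> (complex \<Rightarrow> complex \<Rightarrow> complex) \<Rightarrow> bool"
  for f where
  base: "diff_family f 0 (\<lambda>h. f)"
| diff: "diff_family f k \<phi> \<Longrightarrow> diff_family f (Suc k) (\<lambda>h. eig_diff b h (\<phi> h))"
| add: "diff_family f k \<phi> \<Longrightarrow> diff_family f k \<psi> \<Longrightarrow> diff_family f k (\<lambda>h z. \<phi> h z + \<psi> h z)"
| mult: "diff_family f k \<phi> \<Longrightarrow> diff_family f k (\<lambda>h z. c * \<phi> h z)"
| shift: "diff_family f k \<phi> \<Longrightarrow> diff_family f k (\<lambda>h z. \<phi> h (z - c * h))"

text \<open>Families are generated by the eigen-differences alone; the plain steps are recovered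
  from the pair because \<open>eig\<close> and its conjugate are distinct.\<close>

lemma diff_family_step1:
  assumes "diff_family f k \<phi>"
  shows "diff_family f (Suc k) (\<lambda>h. step1 h (\<phi> h))"
proof -
  have "diff_family f (Suc k) (\<lambda>h z. 1 / (eig - cnj eig) *
      (eig_diff True h (\<phi> h) z + (- 1) * eig_diff False h (\<phi> h) z))"
    by (intro diff_family.intros assms)
  then show ?thesis by (simp add: step1_eq[abs_def])
qed

lemma diff_family_step2:
  assumes "diff_family f k \<phi>"
  shows "diff_family f (Suc k) (\<lambda>h. step2 h (\<phi> h))"
proof -
  have "diff_family f (Suc k) (\<lambda>h z. eig_diff True h (\<phi> h) z + (- eig) * step1 h (\<phi> h) z)"
    by (intro diff_family.intros diff_family_step1 assms)
  then show ?thesis by (simp add: step2_eq[abs_def])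
qed

text \<open>The coarse vector \<open>eig * h\<close> is the sum of the two fine vectors
  \<open>h\<close> and \<open>(eig - 1) * h\<close>.\<close>

lemma step1_coarse: "step1 (eig * h) f z = step1 h f z + step2 h f (z - 1 * h)"
proof -
  have e: "z - 1 * h - (eig - 1) * h = z - eig * h" by algebra
  show ?thesis unfolding step1_def step2_def e by simp
qed

text \<open>Since (eig - 1) eig = - 2, the second coarse vector consists of two fine steps
  backwards; on the lattice this is M e2 = - 2 e1.\<close>

lemma step2_coarse: "step2 (eig * h) f z = - (step1 h f (z - (- 1) * h) + step1 h f (z - (- 2) * h))"
proof -
  have "z - (eig - 1) * (eig * h) = z - (- 2) * h" using eig_square by algebra
  moreover have "z - (- 2) * h - h = z - (- 1) * h" "z - (- 1) * h - h = z" by simp_all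
  ultimately have e: "z - (eig - 1) * (eig * h) = z - (- 2) * h"
    "z - (- 2) * h - h = z - (- 1) * h" "z - (- 1) * h - h = z" .
  show ?thesis unfolding step1_def step2_def e by simp
qed

lemma diff_family_coarse:
  assumes "diff_family f k \<phi>"
  shows "diff_family f (Suc k) (\<lambda>h. eig_diff b (eig * h) (\<phi> h))"
proof -
  have "diff_family f (Suc k) (\<lambda>h z. mult_of b * (step1 h (\<phi> h) z + step2 h (\<phi> h) (z - 1 * h))
     + (- 1) * (step1 h (\<phi> h) (z - (- 1) * h) + step1 h (\<phi> h) (z - (- 2) * h)))"
    by (intro diff_family.add diff_family.mult diff_family_step1 diff_family_step2 assms
        diff_family.shift[where \<phi> = "\<lambda>h. step1 h (\<phi> h)"] diff_family.shift[where \<phi> = "\<lambda>h. step2 h (\<phi> h)"])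
  then show ?thesis by (simp add: eig_diff_def[abs_def] step1_coarse step2_coarse)
qed

text \<open>Moving the shifted first differences of the coarse formulas to the point
  \<open>z\<close> costs second differences; the first differences left at \<open>z\<close> combine
  to the eigenvalue multiple.\<close>

lemma eig_diff_coarse:
  "eig_diff b (eig * h) f z = mult_of b * eig_diff b h f z
     + ((- mult_of b) * step1 h (step2 h f) z
     + (- 1) * (2 * step1 h (step1 h f) (z - (- 1) * h) + step1 h (step1 h f) (z - (- 2) * h)))"
proof -
  have e: "z - (- 1) * h - h = z" "z - (- 2) * h - h = z - (- 1) * h" by simp_all
  have "mult_of b * eig_diff b h f z = mult_of b * step1 h f z - 2 * step1 h f z + mult_of b * step2 h f z"
    by (simp add: eig_diff_def distrib_left mult_of_square left_diff_distrib flip: mult.assoc)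
  then show ?thesis
    unfolding eig_diff_def[of b "eig * h"] step1_coarse step2_coarse
    unfolding step1_def[of h "step2 h f"] step1_def[of h "step1 h f"] e
    by (simp add: algebra_simps)
qed

lemma diff_family_coarse_gap:
  assumes "diff_family f k \<phi>"
  shows "diff_family f (Suc (Suc k))
    (\<lambda>h z. eig_diff b (eig * h) (\<phi> h) z - mult_of b * eig_diff b h (\<phi> h) z)"
proof -
  have "diff_family f (Suc (Suc k)) (\<lambda>h z. (- mult_of b) * step1 h (step2 h (\<phi> h)) z
     + (- 1) * (2 * step1 h (step1 h (\<phi> h)) (z - (- 1) * h) + step1 h (step1 h (\<phi> h)) (z - (- 2) * h)))"
    by (intro diff_family.add diff_family.mult diff_family_step1 diff_family_step2 assms
        diff_family.shift[where \<phi> = "\<lambda>h. step1 h (step1 h (\<phi> h))"])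
  then show ?thesis by (simp add: eig_diff_coarse)
qed

definition scale_of :: "bool list \<Rightarrow> complex" where
  "scale_of ws = prod_list (map mult_of ws)"

lemma norm_scale_of: "norm (scale_of ws) = sqrt 2 ^ length ws"
  by (induction ws) (simp_all add: scale_of_def norm_mult)

lemma diff_family_eig_diffs_coarse: "diff_family f (length ws) (\<lambda>h. eig_diffs ws (eig * h) f)"
proof (induction ws)
  case Nil
  show ?case by (simp add: diff_family.base)
next
  case (Cons b ws)
  from diff_family_coarse[OF this] show ?case by simp
qed

text \<open>Letters are coarsened one at a time. The error at the leading letter gains two orders
  over the remaining word, and the error inside that word gains one from the induction hypothesis
  and one from the letter.\<close>

lemma diff_family_eig_diffs_gap:
  "diff_family f (Suc (length ws)) (\<lambda>h z. eig_diffs ws (eig * h) f z - scale_of ws * eig_diffs ws h f z)"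
proof (induction ws)
  case Nil
  have "diff_family f (Suc 0) (\<lambda>h z. 0 * step1 h f z)"
    by (intro diff_family.mult diff_family_step1 diff_family.base)
  then show ?case by (simp add: scale_of_def)
next
  case (Cons b ws)
  let ?W = "\<lambda>h. eig_diffs ws (eig * h) f" and ?w = "\<lambda>h. eig_diffs ws h f"
  have "diff_family f (Suc (Suc (length ws)))
     (\<lambda>h z. (eig_diff b (eig * h) (?W h) z - mult_of b * eig_diff b h (?W h) z)
       + mult_of b * eig_diff b h (\<lambda>z. ?W h z - scale_of ws * ?w h z) z)"
    by (intro diff_family.add diff_family.mult diff_family.diff diff_family_coarse_gap
        diff_family_eig_diffs_coarse Cons.IH)
  moreover have e: "eig_diff b h (\<lambda>z. ?W h z - scale_of ws * ?w h z) z
      = eig_diff b h (?W h) z - scale_of ws * eig_diff b h (?w h) z" for h z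
    using eig_diff_add[of b h "?W h" "\<lambda>z. - scale_of ws * ?w h z"]
      eig_diff_mult[of b h "- scale_of ws" "?w h"] by simp
  ultimately show ?case
    unfolding e by (simp add: scale_of_def right_diff_distrib mult.assoc)
qed

section \<open>Decay of differences and convergence of scaled differences\<close>

definition diff_decay :: "(complex \<Rightarrow> complex) \<Rightarrow> nat \<Rightarrow> real \<Rightarrow> bool" where
  "diff_decay f k \<theta> \<longleftrightarrow> (\<forall>ws. length ws = k \<longrightarrow>
     (\<exists>C. \<forall>n z. norm (eig_diffs ws (1 / eig ^ n) f z) \<le> C * \<theta> ^ n))"

text \<open>The word \<open>ws\<close> collects the differences already peeled off: the rule
  \<open>diff\<close> appends its letter to it, until at the rule \<open>base\<close> the word has
  the full length \<open>m\<close>.\<close>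

lemma diff_decay_family:
  assumes decay: "diff_decay f m \<theta>" and "diff_family f k \<phi>" and "length ws + k = m"
  shows "\<exists>C. \<forall>n z. norm (eig_diffs ws (1 / eig ^ n) (\<phi> (1 / eig ^ n)) z) \<le> C * \<theta> ^ n"
  using assms(2,3)
proof (induction arbitrary: ws)
  case base
  then show ?case using decay by (simp add: diff_decay_def)
next
  case (diff k \<phi> b)
  then show ?case using diff.IH[of "ws @ [b]"] by (simp add: eig_diffs_snoc)
next
  case (add k \<phi> \<psi>)
  from add.IH(1)[OF add.prems] add.IH(2)[OF add.prems] obtain C D where
    "\<And>n z. norm (eig_diffs ws (1 / eig ^ n) (\<phi> (1 / eig ^ n)) z) \<le> C * \<theta> ^ n"
    "\<And>n z. norm (eig_diffs ws (1 / eig ^ n) (\<psi> (1 / eig ^ n)) z) \<le> D * \<theta> ^ n" by metis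
  then have "norm (eig_diffs ws (1 / eig ^ n) (\<lambda>z. \<phi> (1 / eig ^ n) z + \<psi> (1 / eig ^ n) z) z)
      \<le> (C + D) * \<theta> ^ n" for n z
    unfolding eig_diffs_add distrib_right by (intro norm_triangle_mono)
  then show ?case by blast
next
  case (mult k \<phi> c)
  from mult.IH[OF mult.prems] obtain C where
    C: "\<And>n z. norm (eig_diffs ws (1 / eig ^ n) (\<phi> (1 / eig ^ n)) z) \<le> C * \<theta> ^ n" by metis
  have "norm (eig_diffs ws (1 / eig ^ n) (\<lambda>z. c * \<phi> (1 / eig ^ n) z) z) \<le> (norm c * C) * \<theta> ^ n" for n z
    unfolding eig_diffs_mult norm_mult mult.assoc by (intro mult_left_mono C) auto
  then show ?case by blast
next
  case (shift k \<phi> c)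
  from shift.IH[OF shift.prems] show ?case unfolding eig_diffs_shift by blast
qed

text \<open>The factor compensates the eigenvalue that each letter contributes per change of mesh.
  For smooth \<open>f\<close> the limit is a constant multiple of a mixed Wirtinger derivative, with
  \<open>True\<close> for the derivative in z and \<open>False\<close> for the one in cnj z.\<close>

definition scaled_diffs :: "bool list \<Rightarrow> (complex \<Rightarrow> complex) \<Rightarrow> nat \<Rightarrow> complex \<Rightarrow> complex" where
  "scaled_diffs ws f n z = scale_of ws ^ n * eig_diffs ws (1 / eig ^ n) f z"

lemma scaled_diffs_Cons:
  "scaled_diffs (b # ws) f n z = mult_of b ^ n * eig_diff b (1 / eig ^ n) (scaled_diffs ws f n) z"
  unfolding scaled_diffs_def[abs_def] eig_diff_mult by (simp add: scale_of_def power_mult_distrib)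

lemma scaled_diffs_increment:
  assumes "diff_decay f (Suc (length ws)) \<theta>"
  shows "\<exists>C. \<forall>n z. norm (scaled_diffs ws f (Suc n) z - scaled_diffs ws f n z)
      \<le> C * (\<theta> * sqrt 2 ^ length ws) ^ n"
proof -
  obtain C where C: "\<And>n z. norm (eig_diffs ws (eig * (1 / eig ^ n)) f z
      - scale_of ws * eig_diffs ws (1 / eig ^ n) f z) \<le> C * \<theta> ^ n"
    using diff_decay_family[OF assms diff_family_eig_diffs_gap[of f ws], where ws = "[]"] by auto
  have "norm (scaled_diffs ws f (Suc n) z - scaled_diffs ws f n z)
      \<le> (C * \<theta>) * (\<theta> * sqrt 2 ^ length ws) ^ n" for n z
  proof -
    have "norm (scaled_diffs ws f (Suc n) z - scaled_diffs ws f n z)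
      = norm (scale_of ws ^ n * (eig_diffs ws (eig * (1 / eig ^ Suc n)) f z
          - scale_of ws * eig_diffs ws (1 / eig ^ Suc n) f z))"
      by (simp add: scaled_diffs_def norm_minus_commute algebra_simps)
    also have "\<dots> \<le> (sqrt 2 ^ length ws) ^ n * (C * \<theta> ^ Suc n)"
      unfolding norm_mult norm_power norm_scale_of by (intro mult_left_mono C) auto
    finally show ?thesis by (simp add: power_mult_distrib mult_ac)
  qed
  then show ?thesis by blast
qed

text \<open>The increments are dominated by a geometric series. The limits become the derivatives,
  and the uniform bounds serve to descend to lower orders.\<close>

lemma scaled_diffs_converge:
  assumes decay: "diff_decay f (Suc (length ws)) \<theta>" and \<theta>: "0 < \<theta>" "\<theta> * sqrt 2 ^ length ws < 1"
    and bdd: "\<And>z. norm (f z) \<le> B"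
  shows "\<exists>g. uniform_limit UNIV (scaled_diffs ws f) g sequentially"
    and "\<exists>C. \<forall>n z. norm (scaled_diffs ws f n z) \<le> C"
proof -
  let ?r = "\<theta> * sqrt 2 ^ length ws"
  obtain C where C: "\<And>n z. norm (scaled_diffs ws f (Suc n) z - scaled_diffs ws f n z) \<le> C * ?r ^ n"
    using scaled_diffs_increment[OF decay] by blast
  have sm: "summable (\<lambda>n. C * ?r ^ n)" using \<theta> by (intro summable_mult summable_geometric) auto
  have tel: "scaled_diffs ws f 0 z + (\<Sum>i<n. scaled_diffs ws f (Suc i) z - scaled_diffs ws f i z)
      = scaled_diffs ws f n z" for n z
    using sum_lessThan_telescope[of "\<lambda>n. scaled_diffs ws f n z" n] by simp
  obtain B0 where B0: "\<And>z. norm (scaled_diffs ws f 0 z) \<le> B0"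
  proof -
    have "\<exists>B0. \<forall>z. norm (eig_diffs us 1 f z) \<le> B0" for us
    proof (induction us)
      case (Cons b us)
      then obtain D where D: "\<And>z. norm (eig_diffs us 1 f z) \<le> D" by blast
      have "norm (eig_diffs us 1 f z - eig_diffs us 1 f y) \<le> D + D" for z y
        by (rule order_trans[OF norm_triangle_ineq4 add_mono[OF D D]])
      then have "norm (eig_diffs (b # us) 1 f z) \<le> sqrt 2 * (D + D) + (D + D)" for z
        unfolding eig_diffs.simps eig_diff_def step1_def step2_def
        by (intro norm_triangle_mono) (simp_all only: norm_mult norm_mult_of mult_left_mono
            real_sqrt_ge_zero zero_le_numeral)
      then show ?case by blast
    qed (use bdd in auto)
    then show thesis using that by (auto simp: scaled_diffs_def)
  qed
  have "uniform_limit UNIV (\<lambda>n z. scaled_diffs ws f 0 z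
      + (\<Sum>i<n. scaled_diffs ws f (Suc i) z - scaled_diffs ws f i z))
      (\<lambda>z. scaled_diffs ws f 0 z + (\<Sum>i. scaled_diffs ws f (Suc i) z - scaled_diffs ws f i z)) sequentially"
    by (intro uniform_limit_add uniform_limit_const Weierstrass_m_test[where M = "\<lambda>n. C * ?r ^ n"] sm C)
  then show "\<exists>g. uniform_limit UNIV (scaled_diffs ws f) g sequentially"
    unfolding tel by blast
  have "norm (scaled_diffs ws f n z) \<le> B0 + (\<Sum>i. C * ?r ^ i)" for n z
  proof -
    have nn: "0 \<le> C * ?r ^ i" for i using C[of i 0] norm_ge_zero order_trans by blast
    have "norm (scaled_diffs ws f n z) \<le> norm (scaled_diffs ws f 0 z)
        + norm (\<Sum>i<n. scaled_diffs ws f (Suc i) z - scaled_diffs ws f i z)"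
      unfolding tel[of z n, symmetric] by (rule norm_triangle_ineq)
    also have "\<dots> \<le> B0 + (\<Sum>i<n. C * ?r ^ i)"
      by (intro add_mono B0 sum_norm_le C)
    also have "\<dots> \<le> B0 + (\<Sum>i. C * ?r ^ i)"
      using sm nn by (intro add_left_mono sum_le_suminf) auto
    finally show ?thesis .
  qed
  then show "\<exists>C. \<forall>n z. norm (scaled_diffs ws f n z) \<le> C" by blast
qed

text \<open>Boundedness of the scaled differences of order \<open>k\<close> means that the
  differences themselves decay like the \<open>k\<close>-th power of the mesh, while only the power
  \<open>k - 1\<close> has to be beaten. So decay descends from the top order to every positive
  order below it.\<close>

lemma diff_decay_lower:
  assumes decay: "diff_decay f s \<theta>" and \<theta>: "0 < \<theta>" "\<theta> * sqrt 2 ^ (s - 1) < 1"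
    and bdd: "\<And>z. norm (f z) \<le> B" and "1 \<le> k" "k \<le> s"
  shows "\<exists>\<theta>>0. \<theta> * sqrt 2 ^ (k - 1) < 1 \<and> diff_decay f k \<theta>"
  using \<open>k \<le> s\<close> \<open>1 \<le> k\<close>
proof (induction k rule: inc_induct)
  case base
  then show ?case using decay \<theta> by blast
next
  case (step k)
  then obtain \<eta> where \<eta>: "0 < \<eta>" "\<eta> * sqrt 2 ^ k < 1" "diff_decay f (Suc k) \<eta>" by auto
  define \<kappa> where "\<kappa> = 1 / sqrt 2 ^ k"
  have "diff_decay f k \<kappa>"
    unfolding diff_decay_def
  proof (intro allI impI)
    fix ws :: "bool list" assume ws: "length ws = k"
    have "\<exists>C. \<forall>n z. norm (scaled_diffs ws f n z) \<le> C"
      using \<eta> ws bdd by (intro scaled_diffs_converge(2)[of f ws \<eta> B]) auto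
    then obtain C where C: "\<And>n z. norm (scaled_diffs ws f n z) \<le> C" by blast
    have "norm (eig_diffs ws (1 / eig ^ n) f z) \<le> C * \<kappa> ^ n" for n z
      using C[of n z] by (simp add: scaled_diffs_def norm_mult norm_power norm_scale_of ws \<kappa>_def
          power_divide field_simps)
    then show "\<exists>C. \<forall>n z. norm (eig_diffs ws (1 / eig ^ n) f z) \<le> C * \<kappa> ^ n" by blast
  qed
  moreover have "\<kappa> * sqrt 2 ^ (k - 1) < 1"
    using step.prems by (cases k) (auto simp: \<kappa>_def field_simps)
  moreover have "0 < \<kappa>" by (simp add: \<kappa>_def)
  ultimately show ?case by blast
qed

section \<open>Lattice paths and the derivative of a uniform limit\<close>

lemma telescope_nat:
  fixes \<psi> :: "complex \<Rightarrow> complex"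
  assumes "\<And>j. j < m \<Longrightarrow> norm (\<psi> (z + of_nat (Suc j) * s) - \<psi> (z + of_nat j * s) - c) \<le> \<eta>"
  shows "norm (\<psi> (z + of_nat m * s) - \<psi> z - of_nat m * c) \<le> of_nat m * \<eta>"
  using assms
proof (induction m)
  case (Suc m)
  have "norm ((\<psi> (z + of_nat (Suc m) * s) - \<psi> (z + of_nat m * s) - c)
      + (\<psi> (z + of_nat m * s) - \<psi> z - of_nat m * c)) \<le> \<eta> + of_nat m * \<eta>"
    by (intro norm_triangle_mono Suc) auto
  then show ?case by (simp add: algebra_simps)
qed simp

lemma telescope_int:
  fixes \<psi> :: "complex \<Rightarrow> complex"
  assumes "\<And>j. \<bar>j\<bar> \<le> \<bar>p\<bar> \<Longrightarrow> norm (\<psi> (z + of_int j * s) - \<psi> (z + of_int j * s - s) - c) \<le> \<eta>"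
  shows "norm (\<psi> (z + of_int p * s) - \<psi> z - of_int p * c) \<le> \<bar>of_int p\<bar> * \<eta>"
proof (cases "p \<ge> 0")
  case True
  have "norm (\<psi> (z + of_nat (nat p) * s) - \<psi> z - of_nat (nat p) * c) \<le> of_nat (nat p) * \<eta>"
  proof (rule telescope_nat)
    fix j assume "j < nat p"
    then have "norm (\<psi> (z + of_int (int (Suc j)) * s) - \<psi> (z + of_int (int (Suc j)) * s - s) - c) \<le> \<eta>"
      by (intro assms) auto
    then show "norm (\<psi> (z + of_nat (Suc j) * s) - \<psi> (z + of_nat j * s) - c) \<le> \<eta>"
      by (simp add: algebra_simps)
  qed
  then show ?thesis using True by simp
next
  case False
  have "norm (\<psi> (z + of_nat (nat (- p)) * (- s)) - \<psi> z - of_nat (nat (- p)) * (- c)) \<le> of_nat (nat (- p)) * \<eta>"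
  proof (rule telescope_nat)
    fix j assume "j < nat (- p)"
    then have "norm (\<psi> (z + of_int (- int j) * s) - \<psi> (z + of_int (- int j) * s - s) - c) \<le> \<eta>"
      by (intro assms) auto
    then show "norm (\<psi> (z + of_nat (Suc j) * (- s)) - \<psi> (z + of_nat j * (- s)) - (- c)) \<le> \<eta>"
      by (simp add: algebra_simps norm_minus_commute)
  qed
  then show ?thesis using False by simp
qed

text \<open>As \<open>eig - 1\<close> has norm sqrt 2, the left side is the length of a path from
  the origin along the two lattice vectors. The imaginary part controls \<open>q\<close>, and then
  the real part controls \<open>p\<close>.\<close>

lemma lattice_coordinates_bound:
  "\<bar>p\<bar> + \<bar>q\<bar> * sqrt 2 \<le> 3 * norm (of_real p + of_real q * (eig - 1))"
proof -
  let ?w = "of_real p + of_real q * (eig - 1)"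
  have im: "\<bar>q\<bar> * (sqrt 7 / 2) \<le> norm ?w"
    using abs_Im_le_cmod[of ?w] by (simp add: eig_def abs_mult)
  have re: "\<bar>p - q / 2\<bar> \<le> norm ?w"
    using abs_Re_le_cmod[of ?w] by (simp add: eig_def algebra_simps)
  have "sqrt 2 \<le> 3 / 2" by (rule real_le_lsqrt) (simp_all add: power2_eq_square)
  then have s2: "\<bar>q\<bar> * sqrt 2 \<le> \<bar>q\<bar> * (3 / 2)" by (rule mult_left_mono) simp
  have "2 \<le> sqrt 7" by (rule real_le_rsqrt) simp
  then have "\<bar>q\<bar> * 1 \<le> \<bar>q\<bar> * (sqrt 7 / 2)" by (intro mult_left_mono) auto
  then have "\<bar>q\<bar> \<le> norm ?w" using im by simp
  then show ?thesis using re s2 by linarith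
qed

text \<open>First \<open>q\<close> is read off the imaginary part, then \<open>p\<close> off the
  real part. A crude bound suffices, as it gets multiplied by a mesh tending to zero.\<close>

lemma lattice_rounding:
  "\<exists>p q :: int. norm (w - (of_int p + of_int q * (eig - 1))) \<le> 3"
proof -
  define q where "q = \<lfloor>Im w / (sqrt 7 / 2)\<rfloor>"
  define p where "p = \<lfloor>Re w + q / 2\<rfloor>"
  let ?d = "w - (of_int p + of_int q * (eig - 1))"
  have "Re ?d = (Re w + q / 2) - p" by (simp add: eig_def algebra_simps)
  then have re: "\<bar>Re ?d\<bar> \<le> 1" unfolding p_def by linarith
  let ?x = "Im w / (sqrt 7 / 2) - q"
  have "\<bar>?x\<bar> \<le> 1" unfolding q_def by linarith
  moreover have "sqrt 7 / 2 \<le> 2" using real_le_lsqrt[of 4 7] by simp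
  ultimately have "\<bar>?x\<bar> * (sqrt 7 / 2) \<le> 1 * 2" by (intro mult_mono) auto
  moreover have "Im ?d = ?x * (sqrt 7 / 2)" by (simp add: eig_def field_simps)
  ultimately have "\<bar>Im ?d\<bar> \<le> 2" by (simp only: abs_mult) simp
  then have "norm ?d \<le> 3" using re cmod_le[of ?d] by linarith
  then show ?thesis by blast
qed

(* The increment of the n-th approximation along a lattice path of mesh eig^(-n) is a sum of first
   differences, and such paths are at most three times as long as the segment they replace. *)
lemma derivative_from_scaled_differences:
  assumes \<phi>: "uniform_limit UNIV \<phi>s \<phi> sequentially" "continuous_on UNIV \<phi>"
    and g: "uniform_limit UNIV (\<lambda>n z. mult_of True ^ n * eig_diff True (1 / eig ^ n) (\<phi>s n) z) g sequentially"
      "continuous_on UNIV g"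
    and k: "uniform_limit UNIV (\<lambda>n z. mult_of False ^ n * eig_diff False (1 / eig ^ n) (\<phi>s n) z) k sequentially"
      "continuous_on UNIV k"
  shows "(\<phi> has_derivative (\<lambda>u. g z / (eig - cnj eig) * u + - k z / (eig - cnj eig) * cnj u)) (at z)"
proof -
  let ?\<kappa> = "eig - cnj eig"
  define A where "A = g z / ?\<kappa>"
  define B where "B = - k z / ?\<kappa>"
  define L where "L u = A * u + B * cnj u" for u
  have L_add: "L (x + y) = L x + L y" and L_scale: "L (of_int p * x) = of_int p * L x" for x y p
    by (simp_all add: L_def algebra_simps)
  have L_lin: "bounded_linear L"
    unfolding L_def
    by (intro bounded_linear_add bounded_linear_const_mult bounded_linear_ident bounded_linear_cnj)
  define gs where "gs n z = mult_of True ^ n * eig_diff True (1 / eig ^ n) (\<phi>s n) z" for n z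
  define ks where "ks n z = mult_of False ^ n * eig_diff False (1 / eig ^ n) (\<phi>s n) z" for n z
  define h where "h n = 1 / eig ^ n" for n
  have h0: "norm (h n) = (1 / sqrt 2) ^ n" for n
    by (simp add: h_def norm_divide norm_power power_divide)
  have cnj_h: "cnj (h n) = 1 / (cnj eig) ^ n" for n by (simp add: h_def)
  have e1: "eig_diff True (h n) (\<phi>s n) y = h n * gs n y" for n y
    by (simp add: gs_def h_def mult_of_def)
  have e2: "eig_diff False (h n) (\<phi>s n) y = cnj (h n) * ks n y" for n y
    by (simp add: ks_def cnj_h mult_of_def) (simp add: h_def)
  \<comment> \<open>At every mesh this is exact: along either lattice vector, the increment ending
    at \<open>y\<close> is the value of a real-linear map whose coefficients at \<open>y = z\<close>
    tend to \<open>A\<close> and \<open>B\<close>.\<close>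
  have s1: "step1 (h n) (\<phi>s n) y = gs n y / ?\<kappa> * h n + - ks n y / ?\<kappa> * cnj (h n)" for n y
    unfolding step1_eq e1 e2 by (simp add: diff_divide_distrib mult.commute)
  have s2: "step2 (h n) (\<phi>s n) y
      = gs n y / ?\<kappa> * ((eig - 1) * h n) + - ks n y / ?\<kappa> * cnj ((eig - 1) * h n)" for n y
  proof -
    have "step2 (h n) (\<phi>s n) y = h n * gs n y - eig * ((h n * gs n y - cnj (h n) * ks n y) / ?\<kappa>)"
      unfolding step2_eq step1_eq e1 e2 ..
    also have "\<dots> = (h n * gs n y * (- cnj eig) + eig * (cnj (h n) * ks n y)) / ?\<kappa>"
      using eig_gap by (simp add: field_simps)
    also have "\<dots> = gs n y / ?\<kappa> * ((eig - 1) * h n) + - ks n y / ?\<kappa> * cnj ((eig - 1) * h n)"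
      by (simp add: cnj_eig diff_divide_distrib add_divide_distrib algebra_simps)
    finally show ?thesis .
  qed
  have "\<exists>d>0. \<forall>y. norm (y - z) < d \<longrightarrow> norm (\<phi> y - \<phi> z - L (y - z)) \<le> e * norm (y - z)"
    if "e > 0" for e
  proof -
    \<comment> \<open>The 12 is 4 times 3: each of two coefficients is off by \<open>\<eta>\<close>
      from uniform convergence and by \<open>\<eta>\<close> from continuity, and a lattice path is
      at most three times as long as its chord.\<close>
    define \<eta> where "\<eta> = e / 12"
    have \<eta>: "\<eta> > 0" using that by (simp add: \<eta>_def)
    have close: "\<exists>d>0. \<forall>y. dist y z < d \<longrightarrow> norm (f y - f z) < \<eta> * norm ?\<kappa>"
      if "continuous_on UNIV f" for f :: "complex \<Rightarrow> complex"
    proof -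
      have "0 < \<eta> * norm ?\<kappa>" using \<eta> eig_gap by simp
      with that[unfolded continuous_on_iff] show ?thesis
        unfolding dist_norm by blast
    qed
    obtain d1 where d1: "d1 > 0" "\<And>y. dist y z < d1 \<Longrightarrow> norm (g y - g z) < \<eta> * norm ?\<kappa>"
      using close[OF g(2)] by blast
    obtain d2 where d2: "d2 > 0" "\<And>y. dist y z < d2 \<Longrightarrow> norm (k y - k z) < \<eta> * norm ?\<kappa>"
      using close[OF k(2)] by blast
    \<comment> \<open>A lattice path to a point closer than \<open>d\<close> stays within distance
      \<open>3 * d\<close>, where both continuity estimates apply.\<close>
    define d where "d = min d1 d2 / 3"
    have d0: "d > 0" using d1 d2 by (simp add: d_def)
    have unif: "\<forall>\<^sub>F n in sequentially. \<forall>y. norm (fs n y - f y) < \<eta> * norm ?\<kappa>"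
      if "uniform_limit UNIV fs f sequentially" for fs and f :: "complex \<Rightarrow> complex"
    proof -
      have "0 < \<eta> * norm ?\<kappa>" using \<eta> eig_gap by simp
      from that[unfolded uniform_limit_iff, rule_format, OF this] show ?thesis
        by (simp add: dist_norm)
    qed
    have main: "norm (\<phi> y - \<phi> z - L (y - z)) \<le> e * norm (y - z)" if y: "norm (y - z) < d" for y
    proof -
      define u where "u = y - z"
      have "\<forall>n. \<exists>p q :: int. norm (u / h n - (of_int p + of_int q * (eig - 1))) \<le> 3"
        using lattice_rounding by blast
      then obtain p q :: "nat \<Rightarrow> int" where
        pq: "\<And>n. norm (u / h n - (of_int (p n) + of_int (q n) * (eig - 1))) \<le> 3"
        by metis
      \<comment> \<open>\<open>v n\<close> approximates the increment \<open>u\<close> within the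
        lattice of mesh \<open>h n\<close>. The estimate is shown for \<open>v n\<close> and passes
        to \<open>u\<close> in the limit.\<close>
      define v where "v n = of_int (p n) * h n + of_int (q n) * ((eig - 1) * h n)" for n
      have hn0: "h n \<noteq> 0" for n by (simp add: h_def)
      have nb: "norm (u - v n) \<le> 3 * (1 / sqrt 2) ^ n" for n
      proof -
        have "u - v n = (u / h n - (of_int (p n) + of_int (q n) * (eig - 1))) * h n"
          using hn0 by (simp add: v_def field_simps)
        then have "norm (u - v n) \<le> 3 * norm (h n)"
          unfolding norm_mult using pq[of n] by (metis mult_right_mono norm_ge_zero norm_mult)
        then show ?thesis by (simp add: h0)
      qed
      have "(\<lambda>n. 3 * (1 / sqrt 2) ^ n :: real) \<longlonglongrightarrow> 0"
        by (intro tendsto_mult_right_zero LIMSEQ_power_zero) simp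
      then have "(\<lambda>n. u - v n) \<longlonglongrightarrow> 0"
        by (rule Lim_null_comparison[OF always_eventually[OF allI[OF nb]]])
      from tendsto_diff[OF tendsto_const[of u] this] have v_lim: "v \<longlonglongrightarrow> u" by simp
      have ev: "\<forall>\<^sub>F n in sequentially. norm (\<phi>s n (z + v n) - \<phi>s n z - L (v n)) \<le> e * norm (v n)"
      proof -
        have "\<forall>\<^sub>F n in sequentially. norm (v n) < d"
          using tendsto_norm[OF v_lim] y by (intro order_tendstoD(2)) (auto simp: u_def)
        with unif[OF g(1)] unif[OF k(1)] show ?thesis
        proof eventually_elim
          case (elim n)
          have "norm (of_int (p n) * h n + of_int (q n) * ((eig - 1) * h n))
              = norm (of_real (of_int (p n)) + of_real (of_int (q n)) * (eig - 1)) * norm (h n)"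
            by (simp add: norm_mult[symmetric] algebra_simps)
          moreover have "(\<bar>of_int (p n)\<bar> + \<bar>of_int (q n)\<bar> * sqrt 2) * norm (h n)
            \<le> 3 * norm (of_real (of_int (p n)) + of_real (of_int (q n)) * (eig - 1)) * norm (h n)"
            by (intro mult_right_mono lattice_coordinates_bound) simp
          ultimately have len: "\<bar>of_int (p n)\<bar> * norm (h n) + \<bar>of_int (q n)\<bar> * (sqrt 2 * norm (h n)) \<le> 3 * norm (v n)"
            by (simp add: v_def algebra_simps)
          have norm_e1: "norm (eig - 1) = sqrt 2"
            using norm_mult_of[of False] by (simp add: mult_of_def cnj_eig norm_minus_commute)
          have near: "norm (gs n x / ?\<kappa> - A) \<le> 2 * \<eta>" "norm (- ks n x / ?\<kappa> - B) \<le> 2 * \<eta>"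
            if "norm (x - z) < 3 * d" for x
          proof -
            have "norm (gs n x - g x) < \<eta> * norm ?\<kappa>" "norm (g x - g z) < \<eta> * norm ?\<kappa>"
              "norm (ks n x - k x) < \<eta> * norm ?\<kappa>" "norm (k x - k z) < \<eta> * norm ?\<kappa>"
              using elim d1(2)[of x] d2(2)[of x] that by (auto simp: gs_def ks_def d_def dist_norm)
            then have "norm (gs n x - g z) \<le> 2 * \<eta> * norm ?\<kappa>" "norm (ks n x - k z) \<le> 2 * \<eta> * norm ?\<kappa>"
              using norm_triangle_ineq[of "gs n x - g x" "g x - g z"]
                norm_triangle_ineq[of "ks n x - k x" "k x - k z"] by auto
            moreover have "norm (gs n x / ?\<kappa> - A) = norm (gs n x - g z) / norm ?\<kappa>"
              "norm (- ks n x / ?\<kappa> - B) = norm (ks n x - k z) / norm ?\<kappa>"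
              unfolding A_def B_def by (simp_all add: norm_divide[symmetric] diff_divide_distrib norm_minus_commute)
            ultimately show "norm (gs n x / ?\<kappa> - A) \<le> 2 * \<eta>" "norm (- ks n x / ?\<kappa> - B) \<le> 2 * \<eta>"
              using eig_gap by (simp_all add: divide_le_eq)
          qed
          have step: "norm (gs n x / ?\<kappa> * s + - ks n x / ?\<kappa> * cnj s - L s) \<le> 4 * \<eta> * norm s"
            if "norm (x - z) < 3 * d" for x s
          proof -
            have "gs n x / ?\<kappa> * s + - ks n x / ?\<kappa> * cnj s - L s
                = (gs n x / ?\<kappa> - A) * s + (- ks n x / ?\<kappa> - B) * cnj s"
              by (simp add: L_def algebra_simps)
            also have "norm \<dots> \<le> 2 * \<eta> * norm s + 2 * \<eta> * norm s"
              using near[OF that] by (intro norm_triangle_mono) (auto simp: norm_mult intro: mult_right_mono)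
            finally show ?thesis by simp
          qed
          have 1: "norm (\<phi>s n (z + of_int (p n) * h n) - \<phi>s n z - of_int (p n) * L (h n))
              \<le> \<bar>of_int (p n)\<bar> * (4 * \<eta> * norm (h n))"
          proof (rule telescope_int)
            fix j :: int assume j: "\<bar>j\<bar> \<le> \<bar>p n\<bar>"
            let ?x = "z + of_int j * h n"
            have "norm (?x - z) = real_of_int \<bar>j\<bar> * norm (h n)" by (simp add: norm_mult)
            also have "\<dots> \<le> real_of_int \<bar>p n\<bar> * norm (h n)" using j by (intro mult_right_mono) auto
            also have "\<dots> \<le> 3 * norm (v n)"
            proof -
              have "0 \<le> \<bar>real_of_int (q n)\<bar> * (sqrt 2 * norm (h n))" by simp
              then show ?thesis using len unfolding of_int_abs by linarith
            qed
            finally have "norm (?x - z) < 3 * d" using elim by simp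
            from step[OF this, of "h n"] show "norm (\<phi>s n ?x - \<phi>s n (?x - h n) - L (h n)) \<le> 4 * \<eta> * norm (h n)"
              unfolding s1[symmetric] step1_def by simp
          qed
          let ?z = "z + of_int (p n) * h n" and ?s = "(eig - 1) * h n"
          have 2: "norm (\<phi>s n (?z + of_int (q n) * ?s) - \<phi>s n ?z - of_int (q n) * L ?s)
              \<le> \<bar>of_int (q n)\<bar> * (4 * \<eta> * norm ?s)"
          proof (rule telescope_int)
            fix j :: int assume j: "\<bar>j\<bar> \<le> \<bar>q n\<bar>"
            let ?x = "?z + of_int j * ?s"
            have "norm (?x - z) \<le> norm (of_int (p n) * h n) + norm (of_int j * ?s)"
              using norm_triangle_ineq[of "of_int (p n) * h n" "of_int j * ?s"] by (simp add: add.assoc)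
            also have "\<dots> = real_of_int \<bar>p n\<bar> * norm (h n) + real_of_int \<bar>j\<bar> * (sqrt 2 * norm (h n))"
              by (simp add: norm_mult norm_e1)
            also have "\<dots> \<le> real_of_int \<bar>p n\<bar> * norm (h n) + real_of_int \<bar>q n\<bar> * (sqrt 2 * norm (h n))"
              using j by (intro add_left_mono mult_right_mono) auto
            also have "\<dots> \<le> 3 * norm (v n)" using len by simp
            finally have "norm (?x - z) < 3 * d" using elim by simp
            from step[OF this, of ?s] show "norm (\<phi>s n ?x - \<phi>s n (?x - ?s) - L ?s) \<le> 4 * \<eta> * norm ?s"
              unfolding s2[symmetric] step2_def by simp
          qed
          have "L (v n) = of_int (p n) * L (h n) + of_int (q n) * L ?s"
            unfolding v_def L_add L_scale ..
          then have "\<phi>s n (z + v n) - \<phi>s n z - L (v n)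
              = (\<phi>s n ?z - \<phi>s n z - of_int (p n) * L (h n))
                + (\<phi>s n (?z + of_int (q n) * ?s) - \<phi>s n ?z - of_int (q n) * L ?s)"
            by (simp add: v_def add.assoc)
          also have "norm \<dots> \<le> \<bar>of_int (p n)\<bar> * (4 * \<eta> * norm (h n)) + \<bar>of_int (q n)\<bar> * (4 * \<eta> * norm ?s)"
            by (intro norm_triangle_mono 1 2)
          also have "\<dots> = 4 * \<eta> * (\<bar>of_int (p n)\<bar> * norm (h n) + \<bar>of_int (q n)\<bar> * (sqrt 2 * norm (h n)))"
            unfolding norm_mult norm_e1 by (simp add: distrib_left)
          also have "\<dots> \<le> 4 * \<eta> * (3 * norm (v n))"
            using len \<eta> by (intro mult_left_mono) auto
          finally show ?case by (simp add: \<eta>_def)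
        qed
      qed
      have \<phi>v: "(\<lambda>n. \<phi>s n (z + v n)) \<longlonglongrightarrow> \<phi> (z + u)"
      proof -
        have "(\<lambda>n. \<phi>s n (z + v n) - \<phi> (z + v n)) \<longlonglongrightarrow> 0"
          using \<phi>(1) unfolding uniform_limit_iff tendsto_iff
          by (auto simp: dist_norm elim!: eventually_mono)
        moreover have "(\<lambda>n. \<phi> (z + v n)) \<longlonglongrightarrow> \<phi> (z + u)"
          using \<phi>(2) v_lim by (intro continuous_on_tendsto_compose[of UNIV \<phi>] tendsto_intros) auto
        ultimately show ?thesis using tendsto_add by fastforce
      qed
      have \<phi>z: "(\<lambda>n. \<phi>s n z) \<longlonglongrightarrow> \<phi> z" using \<phi>(1) by (rule tendsto_uniform_limitI) simp
      have "(\<lambda>n. norm (\<phi>s n (z + v n) - \<phi>s n z - L (v n))) \<longlonglongrightarrow> norm (\<phi> (z + u) - \<phi> z - L u)"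
        by (intro tendsto_norm tendsto_diff \<phi>v \<phi>z bounded_linear.tendsto[OF L_lin] v_lim)
      moreover have "(\<lambda>n. e * norm (v n)) \<longlonglongrightarrow> e * norm u" by (intro tendsto_intros v_lim)
      ultimately have "norm (\<phi> (z + u) - \<phi> z - L u) \<le> e * norm u"
        using ev by (intro tendsto_le[OF _ _ _ ev]) auto
      then show ?thesis by (simp add: u_def)
    qed
    then show ?thesis using d0 by blast
  qed
  then have "(\<phi> has_derivative L) (at z)"
    unfolding has_derivative_at_alt using L_lin by blast
  then show ?thesis by (simp add: L_def[abs_def] A_def B_def)
qed

text \<open>Let \<open>G ws\<close> be the limit of the scaled differences for the word
  \<open>ws\<close>. Prefixing a letter to the word differentiates \<open>G ws\<close> in z or cnj z
  up to a constant, and words up to length \<open>r\<close> have limits, which are continuous as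
  uniform limits. Hence \<open>f\<close>, the limit for the empty word, has \<open>r\<close>
  continuous derivatives.\<close>

theorem times_cont_differentiable_of_diff_decay:
  assumes decay: "diff_decay f (Suc r) \<theta>" and \<theta>: "0 < \<theta>" "\<theta> * sqrt 2 ^ r < 1"
    and bdd: "\<And>z. norm (f z) \<le> B" and cont: "continuous_on UNIV f"
  shows "times_cont_differentiable r f"
proof -
  have "\<exists>g. uniform_limit UNIV (scaled_diffs ws f) g sequentially" if ws: "length ws \<le> r" for ws
  proof -
    obtain \<eta> where "0 < \<eta>" "\<eta> * sqrt 2 ^ length ws < 1" "diff_decay f (Suc (length ws)) \<eta>"
      using diff_decay_lower[OF decay \<theta>(1) _ bdd, of "Suc (length ws)"] \<theta> ws by auto
    then show ?thesis using bdd by (intro scaled_diffs_converge(1)[of f ws \<eta> B]) auto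
  qed
  then obtain G where G: "\<And>ws. length ws \<le> r \<Longrightarrow> uniform_limit UNIV (scaled_diffs ws f) (G ws) sequentially"
    by metis
  have G_cont: "continuous_on UNIV (G ws)" if "length ws \<le> r" for ws
  proof (rule uniform_limit_theorem[OF _ G[OF that]])
    show "\<forall>\<^sub>F n in sequentially. continuous_on UNIV (scaled_diffs ws f n)"
      unfolding scaled_diffs_def[abs_def]
      by (intro always_eventually allI continuous_on_mult continuous_on_const continuous_on_eig_diffs cont)
  qed simp
  have G_deriv: "(G ws has_derivative (\<lambda>u. G (True # ws) z / (eig - cnj eig) * u
      + - G (False # ws) z / (eig - cnj eig) * cnj u)) (at z)" if "Suc (length ws) \<le> r" for ws z
    using that G[of "True # ws"] G[of "False # ws"] G[of ws]
    by (intro derivative_from_scaled_differences[where \<phi>s = "scaled_diffs ws f"] G_cont)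
       (simp_all add: scaled_diffs_Cons[abs_def])
  have "times_cont_differentiable k (G ws)" if "length ws + k \<le> r" for k ws
    using that
  proof (induction k arbitrary: ws)
    case 0
    then show ?case by (simp add: G_cont)
  next
    case (Suc k)
    have "G ws differentiable (at z)" for z
      using G_deriv[of ws z] Suc.prems by (auto simp: differentiable_def)
    moreover have "frechet_derivative (G ws) (at z) = (\<lambda>u. G (True # ws) z / (eig - cnj eig) * u
      + - G (False # ws) z / (eig - cnj eig) * cnj u)" for z
      using G_deriv[of ws z] Suc.prems by (intro frechet_derivative_at[symmetric]) auto
    moreover have "times_cont_differentiable k (\<lambda>z. (u / (eig - cnj eig)) * G (True # ws) z
      + (- cnj u / (eig - cnj eig)) * G (False # ws) z)" for u
      using Suc.prems
      by (intro times_cont_differentiable_add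
          times_cont_differentiable_bounded_linear[OF bounded_linear_mult_right] Suc.IH) auto
    ultimately show ?case by (simp add: mult.commute)
  qed
  from this[of "[]" r] have "times_cont_differentiable r (G [])" by simp
  moreover have "G [] = f"
  proof
    fix z
    have "(\<lambda>n. scaled_diffs [] f n z) \<longlonglongrightarrow> G [] z"
      using G[of "[]"] tendsto_uniform_limitI by fastforce
    then show "G [] z = f z"
      by (simp add: scaled_diffs_def scale_of_def LIMSEQ_const_iff)
  qed
  ultimately show ?thesis by simp
qed

section \<open>Refinable functions\<close>

lemma step1_step2_commute: "step1 h (step2 h f) = step2 h (step1 h f)"
  by (simp add: fun_eq_iff step1_def step2_def diff_diff_eq add.commute)

lemma step1_funpow_step2: "(step1 h ^^ i) (step2 h f) = step2 h ((step1 h ^^ i) f)"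
  by (induction i) (simp_all add: step1_step2_commute)

text \<open>A word of eigen-differences expands into monomials in the two commuting steps. Its last
  letter acts first on \<open>f\<close> and is therefore the first to be absorbed into the
  monomial.\<close>

lemma diff_decay_of_steps:
  assumes "\<And>i j. i + j = s \<Longrightarrow> \<exists>C. \<forall>n z.
    norm ((step1 (1 / eig ^ n) ^^ i) ((step2 (1 / eig ^ n) ^^ j) f) z) \<le> C * \<theta> ^ n"
  shows "diff_decay f s \<theta>"
proof -
  have "\<exists>C. \<forall>n z. norm (eig_diffs ws (1 / eig ^ n)
      ((step1 (1 / eig ^ n) ^^ i) ((step2 (1 / eig ^ n) ^^ j) f)) z) \<le> C * \<theta> ^ n"
    if "length ws + i + j = s" for ws i j
    using that
  proof (induction ws arbitrary: i j rule: rev_induct)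
    case Nil
    then show ?case using assms[of i j] by simp
  next
    case (snoc b ws)
    let ?X = "\<lambda>n i j. (step1 (1 / eig ^ n) ^^ i) ((step2 (1 / eig ^ n) ^^ j) f)"
    obtain C where C: "\<And>n z. norm (eig_diffs ws (1 / eig ^ n) (?X n (Suc i) j) z) \<le> C * \<theta> ^ n"
      using snoc.IH[of "Suc i" j] snoc.prems by auto
    obtain D where D: "\<And>n z. norm (eig_diffs ws (1 / eig ^ n) (?X n i (Suc j)) z) \<le> D * \<theta> ^ n"
      using snoc.IH[of i "Suc j"] snoc.prems by auto
    have "norm (eig_diffs (ws @ [b]) (1 / eig ^ n) (?X n i j) z) \<le> (sqrt 2 * C + D) * \<theta> ^ n" for n z
    proof -
      let ?h = "1 / eig ^ n"
      have "eig_diff b ?h (?X n i j) = (\<lambda>z. mult_of b * ?X n (Suc i) j z + ?X n i (Suc j) z)"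
        by (simp add: eig_diff_def[abs_def] step1_funpow_step2)
      then have "eig_diffs (ws @ [b]) ?h (?X n i j) z
          = mult_of b * eig_diffs ws ?h (?X n (Suc i) j) z + eig_diffs ws ?h (?X n i (Suc j)) z"
        unfolding eig_diffs_snoc by (simp only: eig_diffs_add eig_diffs_mult)
      also have "norm \<dots> \<le> sqrt 2 * (C * \<theta> ^ n) + D * \<theta> ^ n"
        by (intro norm_triangle_mono D) (unfold norm_mult norm_mult_of, intro mult_left_mono C, simp)
      finally show ?thesis by (simp add: distrib_right mult.assoc)
    qed
    then show ?case by blast
  qed
  from this[of _ 0 0] show ?thesis by (simp add: diff_decay_def)
qed

section \<open>Lattice sums and the iterated refinement equation\<close>

definition lattice_point :: "int \<times> int \<Rightarrow> complex" where
  "lattice_point = (\<lambda>(a, b). of_int a + of_int b * (eig - 1))"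

text \<open>The functional equation in the complex coordinate: \<open>eig\<close> stands for M and 1
  for e1. It is demanded at every point, because it is applied along lattice translates of a single
  point.\<close>

locale refinable =
  fixes f :: "complex \<Rightarrow> complex" and q :: nat and R F :: real
  assumes refinement: "f z = (\<Sum>k\<le>q. of_real (real (q choose k) / 2 ^ (q - 1)) * f (eig * z - of_nat k))"
    and support: "norm z > R \<Longrightarrow> f z = 0"
    and bounded: "norm (f z) \<le> F"
begin

lemma norm_le_of_nonzero: "f z \<noteq> 0 \<Longrightarrow> norm z \<le> R"
  using support[of z] by force

text \<open>These are the only lattice points whose translate of \<open>f\<close> can be nonzero at
  \<open>y\<close>, so a sum over the whole lattice reduces to this finite set.\<close>

definition near :: "complex \<Rightarrow> (int \<times> int) set" where
  "near y = {p. norm (y - lattice_point p) \<le> R}"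

definition lattice_sum :: "(int \<Rightarrow> int \<Rightarrow> real) \<Rightarrow> complex \<Rightarrow> complex" where
  "lattice_sum g y = (\<Sum>(a, b)\<in>near y. of_real (g a b) * f (y - lattice_point (a, b)))"

text \<open>Two points of \<open>near y\<close> are at distance at most 2 R, so by
  \<open>lattice_coordinates_bound\<close> their coordinates differ by at most 6 R. The count does
  not depend on \<open>y\<close>, which keeps the later estimates uniform.\<close>

lemma card_near:
  "\<exists>N::nat. \<forall>y. finite (near y) \<and> card (near y) \<le> N"
proof -
  define m where "m = \<lceil>6 * R\<rceil>"
  define N where "N = card ({- m..m} \<times> {- m..m})"
  have "finite (near y) \<and> card (near y) \<le> N" for y
  proof (cases "near y = {}")
    case False
    then obtain a0 b0 where p0: "(a0, b0) \<in> near y" by auto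
    have "near y \<subseteq> (\<lambda>(a, b). (a0 + a, b0 + b)) ` ({- m..m} \<times> {- m..m})"
    proof
      fix p assume p: "p \<in> near y"
      obtain a b where ab: "p = (a, b)" by (cases p)
      have e: "of_real (real_of_int (a - a0)) + of_real (real_of_int (b - b0)) * (eig - 1)
          = (y - lattice_point (a0, b0)) - (y - lattice_point p)"
        by (simp add: lattice_point_def ab algebra_simps)
      have "\<bar>real_of_int (a - a0)\<bar> + \<bar>real_of_int (b - b0)\<bar> * sqrt 2 \<le> 3 * (R + R)"
      proof (rule order_trans[OF lattice_coordinates_bound mult_left_mono])
        show "norm (of_real (real_of_int (a - a0)) + of_real (real_of_int (b - b0)) * (eig - 1)) \<le> R + R"
          unfolding e using p p0
          by (intro order_trans[OF norm_triangle_ineq4 add_mono]) (auto simp: near_def)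
      qed simp
      moreover have "\<bar>real_of_int (b - b0)\<bar> * 1 \<le> \<bar>real_of_int (b - b0)\<bar> * sqrt 2"
        by (intro mult_left_mono) auto
      ultimately have s: "\<bar>real_of_int (a - a0)\<bar> + \<bar>real_of_int (b - b0)\<bar> \<le> 6 * R" by argo
      then have "\<bar>real_of_int (a - a0)\<bar> \<le> 6 * R" by linarith
      moreover from s have "\<bar>real_of_int (b - b0)\<bar> \<le> 6 * R" by linarith
      ultimately
      have "\<bar>a - a0\<bar> \<le> m" "\<bar>b - b0\<bar> \<le> m" unfolding m_def by linarith+
      then have "(a - a0, b - b0) \<in> {- m..m} \<times> {- m..m}" by auto
      moreover have "p = (\<lambda>(a, b). (a0 + a, b0 + b)) (a - a0, b - b0)" by (simp add: ab)
      ultimately show "p \<in> (\<lambda>(a, b). (a0 + a, b0 + b)) ` ({- m..m} \<times> {- m..m})" by (rule rev_image_eqI)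
    qed
    then show ?thesis
      unfolding N_def by (meson card_image_le card_mono finite_SigmaI finite_atLeastAtMost_int
          finite_imageI finite_subset order_trans)
  qed simp
  then show ?thesis by blast
qed

lemma finite_near: "finite (near y)"
  using card_near by blast

lemma lattice_sum_superset:
  assumes "finite U" "near y \<subseteq> U"
  shows "lattice_sum g y = (\<Sum>(a, b)\<in>U. of_real (g a b) * f (y - lattice_point (a, b)))"
  unfolding lattice_sum_def
  by (rule sum.mono_neutral_left[OF assms]) (auto simp: near_def dest: norm_le_of_nonzero)

lemma lattice_sum_shift:
  "lattice_sum g (y - lattice_point (c, d)) = lattice_sum (\<lambda>a b. g (a - c) (b - d)) y"
proof -
  have e: "y - lattice_point (a + c, b + d) = y - lattice_point (c, d) - lattice_point (a, b)" for a b
    by (simp add: lattice_point_def algebra_simps)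
  show ?thesis
    unfolding lattice_sum_def
    by (rule sum.reindex_bij_witness[where i = "\<lambda>(a, b). (a - c, b - d)" and j = "\<lambda>(a, b). (a + c, b + d)"])
       (auto simp: near_def e, auto simp: lattice_point_def algebra_simps)
qed

lemma lattice_sum_diff:
  "lattice_sum g y - lattice_sum g' y = lattice_sum (\<lambda>a b. g a b - g' a b) y"
  by (simp add: lattice_sum_def sum_subtractf[symmetric] case_prod_unfold left_diff_distrib)

text \<open>The refinement equation replaces the translate of \<open>f\<close> at p by translates at
  M p + k e1; collecting the coefficients that arrive at a fixed lattice point gives the subdivided
  sequence.\<close>

lemma lattice_sum_subdivision: "lattice_sum (subdivision q g) (eig * w) = lattice_sum g w"
proof -
  define p where "p k = real (q choose k) / 2 ^ (q - 1)" for k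
  define \<phi> where "\<phi> k = (\<lambda>(a, b). (a - 2 * b + int k, a :: int))" for k
  define T where "T k = {x. \<phi> k x \<in> near (eig * w)}" for k
  \<comment> \<open>One finite set that covers the relevant indices for \<open>w\<close> and for
    every \<open>k\<close>, so that the two summations can be exchanged.\<close>
  define U where "U = near w \<union> (\<Union>k\<le>q. T k)"
  have inj: "inj (\<phi> k)" for k by (auto simp: inj_def \<phi>_def)
  have fin: "finite U"
    unfolding U_def T_def using finite_near inj
    by (auto intro!: finite_vimageI[unfolded vimage_def])
  have ref: "f (w - lattice_point (a, b)) = (\<Sum>k\<le>q. of_real (p k) * f (eig * w - lattice_point (\<phi> k (a, b))))" for a b
  proof -
    have "eig * (w - lattice_point (a, b)) - of_nat k = eig * w - lattice_point (\<phi> k (a, b))" for k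
      using eig_square by (simp add: \<phi>_def lattice_point_def) algebra
    then show ?thesis unfolding refinement[of "w - lattice_point (a, b)"] p_def by simp
  qed
  have "lattice_sum g w = (\<Sum>x\<in>U. \<Sum>k\<le>q. of_real (g (fst x) (snd x)) *
      (of_real (p k) * f (eig * w - lattice_point (\<phi> k x))))"
    unfolding lattice_sum_superset[OF fin, of w g, unfolded U_def, OF Un_upper1, folded U_def]
    by (simp add: ref sum_distrib_left case_prod_unfold)
  also have "\<dots> = (\<Sum>k\<le>q. \<Sum>x\<in>U. of_real (g (fst x) (snd x)) *
      (of_real (p k) * f (eig * w - lattice_point (\<phi> k x))))"
    by (rule sum.swap)
  also have "\<dots> = (\<Sum>k\<le>q. \<Sum>x\<in>T k. of_real (g (fst x) (snd x)) *
      (of_real (p k) * f (eig * w - lattice_point (\<phi> k x))))"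
    by (intro sum.cong refl sum.mono_neutral_right fin) (auto simp: U_def T_def near_def dest: norm_le_of_nonzero)
  also have "\<dots> = (\<Sum>k\<le>q. \<Sum>(a, b)\<in>{(a, b)\<in>near (eig * w). even (b - a + int k)}.
      of_real (p k * g b ((b - a + int k) div 2)) * f (eig * w - lattice_point (a, b)))"
  proof (rule sum.cong[OF refl])
    fix k
    show "(\<Sum>x\<in>T k. of_real (g (fst x) (snd x)) * (of_real (p k) * f (eig * w - lattice_point (\<phi> k x))))
      = (\<Sum>(a, b)\<in>{(a, b)\<in>near (eig * w). even (b - a + int k)}.
      of_real (p k * g b ((b - a + int k) div 2)) * f (eig * w - lattice_point (a, b)))"
    proof (rule sum.reindex_bij_witness[where j = "\<phi> k" and i = "\<lambda>(a, b). (b, (b - a + int k) div 2)"])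
      fix x assume x: "x \<in> {(a, b)\<in>near (eig * w). even (b - a + int k)}"
      obtain a b where ab: "x = (a, b)" by (cases x)
      then have "b - 2 * ((b - a + int k) div 2) + int k = a" using x by simp
      then show "\<phi> k (case x of (a, b) \<Rightarrow> (b, (b - a + int k) div 2)) = x"
        "(case x of (a, b) \<Rightarrow> (b, (b - a + int k) div 2)) \<in> T k"
        using x by (simp_all add: ab \<phi>_def T_def)
    qed (auto simp: \<phi>_def T_def case_prod_unfold)
  qed
  also have "\<dots> = (\<Sum>k\<le>q. \<Sum>(a, b)\<in>near (eig * w). if even (b - a + int k) then
      of_real (p k * g b ((b - a + int k) div 2)) * f (eig * w - lattice_point (a, b)) else 0)"
    by (simp only: case_prod_unfold prod.collapse sum.inter_filter[OF finite_near])
  also have "\<dots> = (\<Sum>(a, b)\<in>near (eig * w). \<Sum>k\<le>q. if even (b - a + int k) then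
      of_real (p k * g b ((b - a + int k) div 2)) * f (eig * w - lattice_point (a, b)) else 0)"
    by (subst sum.swap) (simp add: case_prod_unfold)
  also have "\<dots> = lattice_sum (subdivision q g) (eig * w)"
    unfolding lattice_sum_def subdivision_def of_real_sum sum_distrib_right
    by (intro sum.cong refl) (auto simp: p_def intro!: sum.cong)
  finally show ?thesis ..
qed

lemma lattice_sum_iterate: "lattice_sum ((subdivision q ^^ n) unit_seq) (eig ^ n * z) = f z"
proof (induction n)
  case 0
  have "lattice_sum unit_seq z = (\<Sum>x\<in>near z. if x = (0, 0) then f z else 0)"
    unfolding lattice_sum_def by (intro sum.cong refl) (auto simp: unit_seq_def lattice_point_def split: if_splits)
  also have "\<dots> = f z"
    using finite_near support[of z] by (auto simp: near_def lattice_point_def)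
  finally show ?case by simp
next
  case (Suc n)
  then show ?case using lattice_sum_subdivision[of _ "eig ^ n * z"] by (simp add: mult.assoc)
qed

text \<open>A step of mesh \<open>1 / eig ^ n\<close> moves \<open>eig ^ n * z\<close> by a lattice
  vector, and such a translation can be transferred to the coefficients.\<close>

lemma steps_lattice_sum:
  "(step1 (1 / eig ^ n) ^^ i) ((step2 (1 / eig ^ n) ^^ j) (\<lambda>z. lattice_sum g (eig ^ n * z))) z
     = lattice_sum ((diff1 ^^ i) ((diff2 ^^ j) g)) (eig ^ n * z)"
proof -
  let ?L = "\<lambda>g z. lattice_sum g (eig ^ n * z)"
  have 1: "step1 (1 / eig ^ n) (?L g) = ?L (diff1 g)" for g
  proof
    fix z
    have "eig ^ n * (z - 1 / eig ^ n) = eig ^ n * z - lattice_point (1, 0)"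
      by (simp add: lattice_point_def field_simps)
    then show "step1 (1 / eig ^ n) (?L g) z = ?L (diff1 g) z"
      by (simp add: step1_def lattice_sum_shift lattice_sum_diff diff1_def[abs_def])
  qed
  have 2: "step2 (1 / eig ^ n) (?L g) = ?L (diff2 g)" for g
  proof
    fix z
    have "eig ^ n * (z - (eig - 1) * (1 / eig ^ n)) = eig ^ n * z - lattice_point (0, 1)"
      by (simp add: lattice_point_def field_simps)
    then show "step2 (1 / eig ^ n) (?L g) z = ?L (diff2 g) z"
      by (simp add: step2_def lattice_sum_shift lattice_sum_diff diff2_def[abs_def])
  qed
  have "(step2 (1 / eig ^ n) ^^ j) (?L g) = ?L ((diff2 ^^ j) g)"
    by (induction j) (simp_all add: 2)
  moreover have "(step1 (1 / eig ^ n) ^^ i) (?L g) = ?L ((diff1 ^^ i) g)" for g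
    by (induction i) (simp_all add: 1)
  ultimately show ?thesis by simp
qed

text \<open>By \<open>lattice_sum_iterate\<close> the differences of \<open>f\<close> are lattice
  sums of differences of the subdivision sequence; each has a bounded number of terms and
  \<open>f\<close> is bounded, so the rate is inherited.\<close>

lemma diff_decay_of_subdivision:
  assumes "\<And>i j. i + j = s \<Longrightarrow> \<exists>C. \<forall>n a b.
     \<bar>(diff1 ^^ i) ((diff2 ^^ j) ((subdivision q ^^ n) unit_seq)) a b\<bar> \<le> C * \<theta> ^ n"
  shows "diff_decay f s \<theta>"
proof (rule diff_decay_of_steps)
  fix i j assume "i + j = s"
  then obtain C where C: "\<And>n a b. \<bar>(diff1 ^^ i) ((diff2 ^^ j) ((subdivision q ^^ n) unit_seq)) a b\<bar> \<le> C * \<theta> ^ n"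
    using assms by metis
  obtain N where N: "\<And>y. card (near y) \<le> N" using card_near by blast
  have "0 \<le> F" using bounded[of 0] norm_ge_zero order_trans by blast
  have "norm ((step1 (1 / eig ^ n) ^^ i) ((step2 (1 / eig ^ n) ^^ j) f) z) \<le> (N * C * F) * \<theta> ^ n" for n z
  proof -
    let ?g = "(diff1 ^^ i) ((diff2 ^^ j) ((subdivision q ^^ n) unit_seq))"
    have C0: "0 \<le> C * \<theta> ^ n" using C[of n 0 0] by linarith
    have "(step1 (1 / eig ^ n) ^^ i) ((step2 (1 / eig ^ n) ^^ j) f) z = lattice_sum ?g (eig ^ n * z)"
      using steps_lattice_sum[where n = n and i = i and j = j and g = "(subdivision q ^^ n) unit_seq" and z = z] by (simp add: lattice_sum_iterate)
    also have "norm \<dots> \<le> (\<Sum>x\<in>near (eig ^ n * z). (C * \<theta> ^ n) * F)"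
      unfolding lattice_sum_def
      by (intro sum_norm_le) (auto simp: norm_mult C0 intro!: mult_mono C bounded)
    also have "\<dots> = card (near (eig ^ n * z)) * ((C * \<theta> ^ n) * F)" by simp
    also have "\<dots> \<le> N * ((C * \<theta> ^ n) * F)"
      using N mult_nonneg_nonneg[OF C0 \<open>0 \<le> F\<close>] by (intro mult_right_mono) auto
    finally show ?thesis by (simp add: mult_ac)
  qed
  then show "\<exists>C. \<forall>n z. norm ((step1 (1 / eig ^ n) ^^ i) ((step2 (1 / eig ^ n) ^^ j) f) z) \<le> C * \<theta> ^ n"
    by blast
qed

end

section \<open>Lebesgue measure under the dilation\<close>

text \<open>It suffices to compare the measures on boxes, where the claim is the scaling of volume
  by the determinant, applied to the preimage of the box.\<close>

lemma lborel_linear_image: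
  fixes g :: "real^'n::{finite,wellorder} \<Rightarrow> real^'n::_"
  assumes g: "linear g" and d: "det (matrix g) \<noteq> 0"
  shows "density (distr lborel borel g) (\<lambda>_. ennreal \<bar>det (matrix g)\<bar>) = lborel"
proof (rule lborel_eqI[symmetric])
  obtain h where h: "linear h" "\<And>x. h (g x) = x" "\<And>x. g (h x) = x"
    using linear_injective_isomorphism[OF g] det_nz_iff_inj[OF g] d by metis
  have [measurable]: "g \<in> borel_measurable borel"
    using linear_continuous_on linear_conv_bounded_linear g borel_measurable_continuous_onI by blast
  fix l u :: "real^'n::_" assume lu: "\<And>b. b \<in> Basis \<Longrightarrow> l \<bullet> b \<le> u \<bullet> b"
  have vi: "g -` box l u = h ` box l u" using h by (auto simp: image_iff) metis
  have "open (h ` box l u)"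
    unfolding vi[symmetric] using g by (intro open_vimage open_box linear_continuous_on) (simp add: linear_conv_bounded_linear)
  then have hb: "h ` box l u \<in> sets borel" by auto
  have hm: "h ` box l u \<in> lmeasurable"
    by (rule measurable_linear_image[OF h(1) lmeasurable_box])
  have "g ` (h ` box l u) = box l u" using h(3) by (simp add: image_image)
  with measure_linear_image[OF g hm]
  have "measure lebesgue (box l u) = \<bar>det (matrix g)\<bar> * measure lebesgue (h ` box l u)"
    by simp
  then have "ennreal (measure lebesgue (box l u))
      = ennreal \<bar>det (matrix g)\<bar> * ennreal (measure lebesgue (h ` box l u))"
    by (simp add: ennreal_mult)
  then have "emeasure lebesgue (box l u) = ennreal \<bar>det (matrix g)\<bar> * emeasure lebesgue (h ` box l u)"
    by (simp only: emeasure_eq_measure2[OF hm] emeasure_eq_measure2[OF lmeasurable_box])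
  then have "ennreal \<bar>det (matrix g)\<bar> * emeasure lborel (h ` box l u) = emeasure lborel (box l u)"
    using emeasure_completion[of "h ` box l u" lborel] emeasure_completion[of "box l u" lborel] hb by simp
  then show "emeasure (density (distr lborel borel g) (\<lambda>_. ennreal \<bar>det (matrix g)\<bar>)) (box l u)
      = (\<Prod>b\<in>Basis. (u - l) \<bullet> b)"
    using lu by (simp add: emeasure_density emeasure_distr nn_integral_cmult vi emeasure_lborel_box_eq)
qed simp

definition bear_map :: "real^2 \<Rightarrow> real^2" where
  "bear_map x = bear_matrix *v x"

definition bear_e1 :: "real^2" where
  "bear_e1 = vector [1, 0]"

lemma vec2_eq_iff: "(x :: real^2) = y \<longleftrightarrow> x $ 1 = y $ 1 \<and> x $ 2 = y $ 2"
  by (simp add: vec_eq_iff forall_2)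

lemma bear_map_nth [simp]: "bear_map x $ 1 = x $ 1 - 2 * x $ 2" "bear_map x $ 2 = x $ 1"
  by (simp_all add: bear_map_def bear_matrix_def matrix_vector_mult_def sum_2)

lemma bear_e1_nth [simp]: "bear_e1 $ 1 = 1" "bear_e1 $ 2 = 0"
  by (simp_all add: bear_e1_def)

lemma linear_bear_map: "linear bear_map"
  by (rule linearI) (simp_all add: vec2_eq_iff algebra_simps)

lemma det_bear_matrix: "det bear_matrix = 2"
  by (simp add: det_2 bear_matrix_def)

lemma lborel_bear_map: "density (distr lborel borel bear_map) (\<lambda>_. 2) = lborel"
  using lborel_linear_image[OF linear_bear_map]
  by (simp add: bear_map_def[abs_def] matrix_of_matrix_vector_mul det_bear_matrix)

lemma bear_map_measurable [measurable]: "bear_map \<in> borel_measurable borel"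
  using linear_continuous_on linear_conv_bounded_linear linear_bear_map borel_measurable_continuous_onI by blast

lemma integral_bear_map:
  fixes \<phi> :: "real^2 \<Rightarrow> real"
  assumes [measurable]: "\<phi> \<in> borel_measurable borel"
  shows "integrable lborel (\<lambda>x. \<phi> (bear_map x)) \<longleftrightarrow> integrable lborel \<phi>"
    and "(\<integral>x. \<phi> (bear_map x) \<partial>lborel) = (\<integral>x. \<phi> x \<partial>lborel) / 2"
proof -
  have "integrable lborel \<phi> \<longleftrightarrow> integrable (density (distr lborel borel bear_map) (\<lambda>_. ennreal 2)) \<phi>"
    using lborel_bear_map by simp
  also have "\<dots> \<longleftrightarrow> integrable lborel (\<lambda>x. 2 * \<phi> (bear_map x))"
    by (subst integrable_real_density) (simp_all add: integrable_distr_eq)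
  finally show "integrable lborel (\<lambda>x. \<phi> (bear_map x)) \<longleftrightarrow> integrable lborel \<phi>" by simp
  have "integral\<^sup>L lborel \<phi> = integral\<^sup>L (density (distr lborel borel bear_map) (\<lambda>_. ennreal 2)) \<phi>"
    using lborel_bear_map by simp
  also have "\<dots> = (\<integral>x. 2 * \<phi> (bear_map x) \<partial>lborel)"
    by (subst integral_real_density) (simp_all add: integral_distr)
  finally show "(\<integral>x. \<phi> (bear_map x) \<partial>lborel) = (\<integral>x. \<phi> x \<partial>lborel) / 2" by simp
qed

lemma lborel_translation:
  fixes \<phi> :: "'a::euclidean_space \<Rightarrow> real"
  assumes [measurable]: "\<phi> \<in> borel_measurable borel"
  shows "integrable lborel (\<lambda>x. \<phi> (x - c)) \<longleftrightarrow> integrable lborel \<phi>"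
    and "(\<integral>x. \<phi> (x - c) \<partial>lborel) = (\<integral>x. \<phi> x \<partial>lborel)"
proof -
  have "integrable lborel \<phi> \<longleftrightarrow> integrable (distr lborel borel ((+) (- c))) \<phi>"
    by (simp add: lborel_distr_plus)
  then show "integrable lborel (\<lambda>x. \<phi> (x - c)) \<longleftrightarrow> integrable lborel \<phi>"
    by (simp add: integrable_distr_eq)
  have "integral\<^sup>L lborel \<phi> = integral\<^sup>L (distr lborel borel ((+) (- c))) \<phi>"
    by (simp add: lborel_distr_plus)
  then show "(\<integral>x. \<phi> (x - c) \<partial>lborel) = (\<integral>x. \<phi> x \<partial>lborel)"
    by (simp add: integral_distr)
qed

lemma lborel_distr_reflection:
  "distr lborel borel (\<lambda>t. c - t) = (lborel :: 'a::euclidean_space measure)"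
  using lborel_affine[of "- 1" c] by (simp add: density_1)

lemma lborel_reflection:
  fixes \<phi> :: "'a::euclidean_space \<Rightarrow> real"
  assumes [measurable]: "\<phi> \<in> borel_measurable borel"
  shows "integrable lborel (\<lambda>x. \<phi> (c - x)) \<longleftrightarrow> integrable lborel \<phi>"
    and "(\<integral>x. \<phi> (c - x) \<partial>lborel) = (\<integral>x. \<phi> x \<partial>lborel)"
proof -
  have "integrable lborel \<phi> \<longleftrightarrow> integrable (distr lborel borel (\<lambda>t. c - t)) \<phi>"
    by (simp only: lborel_distr_reflection)
  then show "integrable lborel (\<lambda>x. \<phi> (c - x)) \<longleftrightarrow> integrable lborel \<phi>"
    by (simp add: integrable_distr_eq)
  have "integral\<^sup>L lborel \<phi> = integral\<^sup>L (distr lborel borel (\<lambda>t. c - t)) \<phi>"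
    by (simp only: lborel_distr_reflection)
  then show "(\<integral>x. \<phi> (c - x) \<partial>lborel) = (\<integral>x. \<phi> x \<partial>lborel)"
    by (simp add: integral_distr)
qed

lemma AE_reflection:
  assumes "AE x in lborel. P (x :: 'a::euclidean_space)"
  shows "AE t in lborel. P (c - t)"
proof -
  have "AE x in distr lborel borel (\<lambda>t. c - t). P x" using assms by (simp only: lborel_distr_reflection)
  then show ?thesis by (rule AE_distrD[rotated]) simp
qed

lemma integrable_bounded_support:
  fixes f :: "'a::euclidean_space \<Rightarrow> real"
  assumes [measurable]: "f \<in> borel_measurable borel"
    and "\<And>x. \<bar>f x\<bar> \<le> B" and "\<And>x. norm x > r \<Longrightarrow> f x = 0"
  shows "integrable lborel f"
proof -
  have "integrable lborel (\<lambda>x. indicator (cball 0 r) x *\<^sub>R B)"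
    by (intro integrable_indicator) (auto simp: emeasure_bounded_finite[OF bounded_cball, simplified])
  then show ?thesis
    by (rule Bochner_Integration.integrable_bound)
       (use assms in \<open>auto simp: indicator_def not_le intro!: AE_I2 order_trans[OF assms(2)]\<close>)
qed


section \<open>The Bear tile and its B-splines\<close>

definition bear_coord :: "real^2 \<Rightarrow> complex" where
  "bear_coord x = of_real (x $ 1) + of_real (x $ 2) * (eig - 1)"

definition bear_vec :: "complex \<Rightarrow> real^2" where
  "bear_vec w = vector [Re w + Im w / sqrt 7, 2 * Im w / sqrt 7]"

lemma bear_vec_nth [simp]: "bear_vec w $ 1 = Re w + Im w / sqrt 7" "bear_vec w $ 2 = 2 * Im w / sqrt 7"
  by (simp_all add: bear_vec_def)

lemma bear_coord_vec [simp]: "bear_coord (bear_vec w) = w"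
  by (simp add: bear_coord_def complex_eq_iff eig_def field_simps)

lemma bear_vec_coord [simp]: "bear_vec (bear_coord x) = x"
  by (simp add: bear_coord_def vec2_eq_iff eig_def field_simps)

lemma bounded_linear_bear_coord: "bounded_linear bear_coord"
  unfolding linear_conv_bounded_linear[symmetric]
  by (rule linearI) (simp_all add: bear_coord_def complex_eq_iff algebra_simps)

lemma bounded_linear_bear_vec: "bounded_linear bear_vec"
  unfolding linear_conv_bounded_linear[symmetric]
  by (rule linearI) (simp_all add: vec2_eq_iff field_simps)

lemma bear_coord_map: "bear_coord (bear_map x) = eig * bear_coord x"
proof -
  have "eig * bear_coord x = of_real (x $ 1) * eig + of_real (x $ 2) * (eig * eig - eig)"
    by (simp add: bear_coord_def algebra_simps)
  then show ?thesis by (simp add: eig_square) (simp add: bear_coord_def algebra_simps)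
qed

lemma bear_coord_bear_e1 [simp]: "bear_coord bear_e1 = 1"
  by (simp add: bear_coord_def)

lemma bear_coord_diff: "bear_coord (x - y) = bear_coord x - bear_coord y"
  by (simp add: bear_coord_def algebra_simps)

lemma bear_coord_mat_power:
  "bear_coord (mat_power (matrix_inv bear_matrix) k *v d) = bear_coord d / eig ^ k"
proof (induction k)
  case (Suc k)
  have "bear_matrix ** matrix_inv bear_matrix = mat 1"
    using det_bear_matrix invertible_det_nz[of bear_matrix]
    unfolding matrix_inv_def invertible_def by (intro someI2_ex[where Q = "\<lambda>A. bear_matrix ** A = mat 1"]) auto
  then have "bear_map (matrix_inv bear_matrix *v y) = y" for y
    by (simp add: bear_map_def matrix_vector_mul_assoc)
  then have "bear_coord (matrix_inv bear_matrix *v y) = bear_coord y / eig" for y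
    using bear_coord_map[of "matrix_inv bear_matrix *v y"] by (simp add: field_simps)
  then show ?case
    using Suc by (simp add: matrix_vector_mul_assoc[symmetric])
qed simp

text \<open>Both digits are multiples of e1, whose coordinate is 1, so the tile consists of the
  expansions in base \<open>eig\<close> with digits 0 and 1. The index moves by one:
  \<open>s k\<close> is the digit number \<open>Suc k\<close> of the tile.\<close>

lemma mem_bear_tile_iff:
  "x \<in> bear_tile \<longleftrightarrow> (\<exists>s::nat \<Rightarrow> real. (\<forall>k. s k \<in> {0, 1}) \<and>
     (\<lambda>k. of_real (s k) / eig ^ Suc k) sums bear_coord x)"
proof
  assume "x \<in> bear_tile"
  then obtain \<Delta> where \<Delta>: "\<And>k. k \<ge> 1 \<Longrightarrow> \<Delta> k \<in> bear_digits"
    and sums: "(\<lambda>k. mat_power (matrix_inv bear_matrix) (Suc k) *v \<Delta> (Suc k)) sums x"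
    by (auto simp: bear_tile_def tile_def)
  have d: "bear_coord (\<Delta> (Suc k)) = of_real (\<Delta> (Suc k) $ 1)" "\<Delta> (Suc k) $ 1 \<in> {0, 1}" for k
    using \<Delta>[of "Suc k"] by (auto simp: bear_digits_def bear_coord_def)
  have "(\<lambda>k. of_real (\<Delta> (Suc k) $ 1) / eig ^ Suc k) sums bear_coord x"
    using bounded_linear.sums[OF bounded_linear_bear_coord sums] unfolding bear_coord_mat_power d .
  then show "\<exists>s::nat \<Rightarrow> real. (\<forall>k. s k \<in> {0, 1}) \<and> (\<lambda>k. of_real (s k) / eig ^ Suc k) sums bear_coord x"
    using d(2) by (intro exI[of _ "\<lambda>k. \<Delta> (Suc k) $ 1"]) blast
next
  assume "\<exists>s::nat \<Rightarrow> real. (\<forall>k. s k \<in> {0, 1}) \<and> (\<lambda>k. of_real (s k) / eig ^ Suc k) sums bear_coord x"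
  then obtain s :: "nat \<Rightarrow> real" where s: "\<And>k. s k \<in> {0, 1}"
    and sums: "(\<lambda>k. of_real (s k) / eig ^ Suc k) sums bear_coord x" by blast
  define \<Delta> :: "nat \<Rightarrow> real^2" where "\<Delta> k = vector [s (k - 1), 0]" for k
  have dig: "\<Delta> k \<in> bear_digits" for k
    using s[of "k - 1"] by (auto simp: \<Delta>_def bear_digits_def)
  have "bear_coord (\<Delta> (Suc k)) = of_real (s k)" for k
    by (simp add: \<Delta>_def bear_coord_def)
  then have "of_real (s k) / eig ^ Suc k
      = bear_coord (mat_power (matrix_inv bear_matrix) (Suc k) *v \<Delta> (Suc k))" for k
    by (simp only: bear_coord_mat_power)
  with bounded_linear.sums[OF bounded_linear_bear_vec sums]
  have "(\<lambda>k. mat_power (matrix_inv bear_matrix) (Suc k) *v \<Delta> (Suc k)) sums x"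
    by (simp only: bear_vec_coord)
  then show "x \<in> bear_tile" using dig by (auto simp: bear_tile_def tile_def)
qed

text \<open>The dilation shifts the digit expansion by one place; the leading digit that splits off
  is 0 or 1.\<close>

lemma bear_tile_self_similar:
  "x \<in> bear_tile \<longleftrightarrow> bear_map x \<in> bear_tile \<or> bear_map x - bear_e1 \<in> bear_tile"
proof
  assume "x \<in> bear_tile"
  then obtain s :: "nat \<Rightarrow> real" where s: "\<And>k. s k \<in> {0, 1}"
    and sums: "(\<lambda>k. of_real (s k) / eig ^ Suc k) sums bear_coord x"
    using mem_bear_tile_iff by blast
  have "(\<lambda>k. of_real (s k) / eig ^ k) sums bear_coord (bear_map x)"
    using sums_mult[OF sums, of eig] by (simp add: bear_coord_map field_simps)
  then have "(\<lambda>k. of_real (s (Suc k)) / eig ^ Suc k) sums (bear_coord (bear_map x) - of_real (s 0))"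
    by (subst sums_Suc_iff) simp
  moreover have "s 0 = 0 \<or> s 0 = 1" using s[of 0] by simp
  ultimately show "bear_map x \<in> bear_tile \<or> bear_map x - bear_e1 \<in> bear_tile"
    unfolding mem_bear_tile_iff bear_coord_diff bear_coord_bear_e1
    using s by (elim disjE) (auto intro!: exI[of _ "\<lambda>k. s (Suc k)"])
next
  have "x \<in> bear_tile" if t: "bear_map x - y \<in> bear_tile" "bear_coord y = of_real d" "d \<in> {0, 1}" for y d
  proof -
    obtain s :: "nat \<Rightarrow> real" where s: "\<And>k. s k \<in> {0, 1}"
      and sums: "(\<lambda>k. of_real (s k) / eig ^ Suc k) sums (bear_coord (bear_map x) - of_real d)"
      using t(1)[unfolded mem_bear_tile_iff bear_coord_diff t(2)] by blast
    define t where "t k = (case k of 0 \<Rightarrow> d | Suc k \<Rightarrow> s k)" for k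
    have "(\<lambda>k. of_real (t k) / eig ^ k) sums (bear_coord (bear_map x))"
      using sums_Suc[of "\<lambda>k. of_real (t k) / eig ^ k"] sums by (force simp: t_def)
    then have "(\<lambda>k. of_real (t k) / eig ^ Suc k) sums bear_coord x"
      using sums_divide[of "\<lambda>k. of_real (t k) / eig ^ k" _ eig]
      by (fastforce simp: bear_coord_map mult.commute)
    moreover have "t k \<in> {0, 1}" for k using s t(3) by (simp add: t_def split: nat.split)
    ultimately show ?thesis unfolding mem_bear_tile_iff by blast
  qed
  from this[of 0 0] this[of bear_e1 1]
  show "bear_map x \<in> bear_tile \<or> bear_map x - bear_e1 \<in> bear_tile \<Longrightarrow> x \<in> bear_tile"
    by (auto simp: bear_coord_def)
qed

text \<open>The tile is a continuous image of the space of 0-1 sequences, which is compact by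
  Tychonoff; continuity holds because the series is dominated by the powers of 1 / sqrt 2.\<close>

lemma compact_bear_tile: "compact bear_tile"
proof -
  define S :: "(nat \<Rightarrow> real) set" where "S = (\<Pi>\<^sub>E k\<in>UNIV. {0, 1})"
  define F where "F s = (\<Sum>k. of_real (s k) / eig ^ Suc k)" for s :: "nat \<Rightarrow> real"
  have S: "s \<in> S \<longleftrightarrow> (\<forall>k. s k \<in> {0, 1})" for s by (auto simp: S_def PiE_def Pi_def)
  have bound: "norm (of_real (s k) / eig ^ Suc k) \<le> (1 / sqrt 2) ^ Suc k" if "s \<in> S" for s k
  proof -
    have "\<bar>s k\<bar> \<le> 1" using that S[of s] by (metis abs_0 abs_1 insertE order_refl singletonD zero_le_one)
    then show ?thesis by (simp add: norm_divide norm_power norm_mult power_divide divide_right_mono)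
  qed
  have sm: "summable (\<lambda>k. (1 / sqrt 2) ^ Suc k :: real)"
    by (intro summable_Suc_iff[THEN iffD2] summable_geometric) simp
  have sumF: "(\<lambda>k. of_real (s k) / eig ^ Suc k) sums F s" if "s \<in> S" for s
    unfolding F_def using that bound by (intro summable_sums summable_comparison_test'[OF sm]) auto
  have "compactin (product_topology (\<lambda>_::nat. euclidean :: real topology) UNIV) S"
    unfolding S_def by (subst compactin_PiE) (auto intro: finite_imp_compact)
  then have "compact S" by (simp add: euclidean_product_topology)
  moreover have "continuous_on S F"
  proof (rule uniform_limit_theorem)
    show "uniform_limit S (\<lambda>n s. \<Sum>k<n. of_real (s k) / eig ^ Suc k) F sequentially"
      unfolding F_def by (rule Weierstrass_m_test[OF bound sm])
    show "\<forall>\<^sub>F n in sequentially. continuous_on S (\<lambda>s. \<Sum>k<n. of_real (s k) / eig ^ Suc k)"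
      by (intro always_eventually allI continuous_on_sum continuous_on_divide continuous_on_const
          continuous_on_of_real continuous_on_subset[OF continuous_on_product_coordinates]) auto
  qed simp
  ultimately have "compact (F ` S)" by (metis compact_continuous_image)
  then have "compact (bear_vec ` F ` S)"
    by (rule compact_continuous_image[OF linear_continuous_on[OF bounded_linear_bear_vec]])
  moreover have "bear_tile = bear_vec ` F ` S"
  proof safe
    fix x assume "x \<in> bear_tile"
    then obtain s where s: "s \<in> S" "(\<lambda>k. of_real (s k) / eig ^ Suc k) sums bear_coord x"
      using mem_bear_tile_iff S by blast
    then have "F s = bear_coord x" using sumF sums_unique2 by blast
    then show "x \<in> bear_vec ` F ` S" using s(1) by (metis bear_vec_coord imageI)
  next
    fix s assume "s \<in> S"
    then show "bear_vec (F s) \<in> bear_tile"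
      using sumF S unfolding mem_bear_tile_iff bear_coord_vec by blast
  qed
  ultimately show ?thesis by simp
qed

lemma zero_in_bear_tile: "0 \<in> bear_tile"
  unfolding mem_bear_tile_iff by (intro exI[of _ "\<lambda>_. 0"]) (simp add: bear_coord_def)

section \<open>Convolutions of bounded functions with bounded support\<close>

definition bdd_supported :: "('a::euclidean_space \<Rightarrow> real) \<Rightarrow> bool" where
  "bdd_supported f \<longleftrightarrow> f \<in> borel_measurable borel \<and> (\<exists>B. \<forall>x. \<bar>f x\<bar> \<le> B) \<and> (\<exists>r. \<forall>x. norm x > r \<longrightarrow> f x = 0)"

lemma bdd_supported_measurable [measurable_dest]: "bdd_supported f \<Longrightarrow> f \<in> borel_measurable borel"
  by (simp add: bdd_supported_def)

lemma bdd_supported_integrable: "bdd_supported f \<Longrightarrow> integrable lborel f"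
  unfolding bdd_supported_def using integrable_bounded_support by blast

lemma bdd_supported_mult:
  assumes "bdd_supported f" "bdd_supported g"
  shows "bdd_supported (\<lambda>t. f (t - a) * g (b - t))"
proof -
  obtain B C r where "\<And>x. \<bar>f x\<bar> \<le> B" "\<And>x. \<bar>g x\<bar> \<le> C" and r: "\<And>x. norm x > r \<Longrightarrow> f x = 0"
    using assms unfolding bdd_supported_def by blast
  then have "\<bar>f (t - a) * g (b - t)\<bar> \<le> B * C" for t
    unfolding abs_mult using abs_ge_zero order_trans by (intro mult_mono) blast+
  moreover have "f (t - a) * g (b - t) = 0" if "norm t > r + norm a" for t
    using r[of "t - a"] norm_triangle_ineq2[of t a] that by simp
  moreover have "(\<lambda>t. f (t - a) * g (b - t)) \<in> borel_measurable borel"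
    using assms[THEN bdd_supported_measurable] by measurable
  ultimately show ?thesis unfolding bdd_supported_def by blast
qed

lemma bdd_supported_indicator: "compact G \<Longrightarrow> bdd_supported (indicator G)"
proof -
  assume G: "compact G"
  then obtain r where "\<And>x. x \<in> G \<Longrightarrow> norm x \<le> r"
    using compact_imp_bounded bounded_iff by metis
  then have "\<forall>x. norm x > r \<longrightarrow> indicator G x = (0::real)" by (force simp: indicator_def)
  moreover have "\<forall>x. \<bar>indicator G x :: real\<bar> \<le> 1" by (simp add: indicator_def)
  ultimately show ?thesis
    unfolding bdd_supported_def using compact_imp_closed[OF G] by (intro conjI exI) auto
qed

lemma bdd_supported_convolution:
  assumes f: "bdd_supported f" and g: "bdd_supported g"
  shows "bdd_supported (convolution f g)"
proof -
  note [measurable] = f[THEN bdd_supported_measurable] g[THEN bdd_supported_measurable]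
  obtain B C r r' where bounds: "\<And>x. \<bar>f x\<bar> \<le> B" "\<And>x. \<bar>g x\<bar> \<le> C"
    and r: "\<And>x. norm x > r \<Longrightarrow> f x = 0" and r': "\<And>x. norm x > r' \<Longrightarrow> g x = 0"
    using f g unfolding bdd_supported_def by metis
  have "convolution f g \<in> borel_measurable borel"
    unfolding convolution_def[abs_def] by measurable
  moreover have "\<bar>convolution f g x\<bar> \<le> (\<integral>t. \<bar>f t\<bar> * C \<partial>lborel)" for x
  proof -
    have int: "integrable lborel (\<lambda>t. f t * g (x - t))"
      using bdd_supported_integrable[OF bdd_supported_mult[OF f g, of 0 x]] by simp
    have "\<bar>convolution f g x\<bar> \<le> (\<integral>t. \<bar>f t * g (x - t)\<bar> \<partial>lborel)"
      unfolding convolution_def by (rule integral_abs_bound)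
    also have "\<dots> \<le> (\<integral>t. \<bar>f t\<bar> * C \<partial>lborel)"
      using bdd_supported_integrable[OF f] bounds
      by (intro integral_mono integrable_abs[OF int]) (auto simp: abs_mult intro!: mult_left_mono)
    finally show ?thesis .
  qed
  moreover have "convolution f g x = 0" if "norm x > r + r'" for x
  proof -
    have "f t * g (x - t) = 0" for t
      using r[of t] r'[of "x - t"] norm_triangle_ineq[of t "x - t"] that by force
    then have "(\<lambda>t. f t * g (x - t)) = (\<lambda>_. 0)" by (rule ext)
    then show ?thesis by (simp only: convolution_def) simp
  qed
  ultimately show ?thesis unfolding bdd_supported_def by blast
qed

lemma continuous_convolution:
  assumes f: "bdd_supported f" and h: "continuous_on UNIV h" "bdd_supported h"
  shows "continuous_on UNIV (convolution f h)"
proof -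
  note [measurable] = f[THEN bdd_supported_measurable] h(2)[THEN bdd_supported_measurable]
  obtain C where C: "\<And>x. \<bar>h x\<bar> \<le> C" using h(2) unfolding bdd_supported_def by blast
  have "(\<lambda>n. convolution f h (X n)) \<longlonglongrightarrow> convolution f h x" if X: "X \<longlonglongrightarrow> x" for X x
    unfolding convolution_def
  proof (rule integral_dominated_convergence[where w = "\<lambda>t. \<bar>f t\<bar> * C"])
    show "integrable lborel (\<lambda>t. \<bar>f t\<bar> * C)" using bdd_supported_integrable[OF f] by simp
    have "(\<lambda>n. h (X n - t)) \<longlonglongrightarrow> h (x - t)" for t
      using h(1) X by (intro continuous_on_tendsto_compose[of UNIV h] tendsto_intros) auto
    then show "AE t in lborel. (\<lambda>n. f t * h (X n - t)) \<longlonglongrightarrow> f t * h (x - t)"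
      by (intro AE_I2 tendsto_mult tendsto_const)
    show "AE t in lborel. norm (f t * h (X n - t)) \<le> \<bar>f t\<bar> * C" for n
      using C by (intro AE_I2) (simp add: abs_mult mult_left_mono)
  qed measurable
  then show ?thesis by (auto simp: continuous_on_sequentially o_def)
qed

text \<open>Lipschitz functions decrease to the indicator because \<open>G\<close> is closed. Their
  L1 distance to it times a bound for \<open>f\<close> controls the error of the convolution at all
  points at once, so the convolution is a uniform limit of continuous functions.\<close>

lemma continuous_convolution_indicator:
  fixes f :: "'a::euclidean_space \<Rightarrow> real"
  assumes f: "bdd_supported f" and G: "compact G" "G \<noteq> {}"
  shows "continuous_on UNIV (convolution f (indicator G))"
proof -
  note [measurable] = f[THEN bdd_supported_measurable] bdd_supported_indicator[OF G(1), THEN bdd_supported_measurable]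
  define h where "h n y = max 0 (1 - real (Suc n) * infdist y G)" for n y
  have h_cont: "continuous_on UNIV (h n)" for n
    unfolding h_def by (intro continuous_intros)
  then have [measurable]: "h n \<in> borel_measurable borel" for n by (rule borel_measurable_continuous_onI)
  obtain r where r: "\<And>x. x \<in> G \<Longrightarrow> norm x \<le> r"
    using G(1) compact_imp_bounded bounded_iff by metis
  have h_range: "0 \<le> h n y" "h n y \<le> 1" for n y
    using infdist_nonneg[of y G] by (auto simp: h_def)
  have h_mono: "h n y \<le> h 0 y" for n y
    using infdist_nonneg[of y G] mult_right_mono[of 1 "real (Suc n)" "infdist y G"] by (auto simp: h_def)
  have h_G: "h n y = 1" if "y \<in> G" for n y using that by (simp add: h_def)
  have h0: "h 0 y = 0" if "norm y > r + 1" for y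
  proof -
    obtain x where "x \<in> G" "infdist y G = dist y x"
      using infdist_attains_inf[of G y] G compact_imp_closed by metis
    then have "infdist y G \<ge> 1" using r[of x] that norm_triangle_ineq2[of y x] by (simp add: dist_norm)
    then show ?thesis by (simp add: h_def)
  qed
  have h_bdd_supported: "bdd_supported (h n)" for n
  proof -
    have "h n y = 0" if "norm y > r + 1" for y
      using h0[OF that] h_mono[of n y] h_range(1)[of n y] by simp
    moreover have "\<bar>h n y\<bar> \<le> 1" for y using h_range[where n = n and y = y] by simp
    ultimately show ?thesis unfolding bdd_supported_def by auto
  qed
  have gap: "0 \<le> h n y - indicator G y" "h n y - indicator G y \<le> h 0 y" for n y
    using h_range[where n = n and y = y] h_mono[of n y] h_G[of y n] by (auto simp: indicator_def)
  have gap_int: "integrable lborel (\<lambda>y. h n y - indicator G y)" for n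
    by (intro Bochner_Integration.integrable_diff bdd_supported_integrable h_bdd_supported bdd_supported_indicator G)
  have lim: "(\<lambda>n. \<integral>y. h n y - indicator G y \<partial>lborel) \<longlonglongrightarrow> integral\<^sup>L lborel (\<lambda>_::'a. 0 :: real)"
  proof (rule integral_dominated_convergence[where w = "h 0"])
    show "integrable lborel (h 0)" by (rule bdd_supported_integrable[OF h_bdd_supported])
    have "(\<lambda>n. h n y - indicator G y) \<longlonglongrightarrow> 0" for y
    proof (cases "y \<in> G")
      case True
      then show ?thesis by (simp add: h_G)
    next
      case False
      then have pos: "infdist y G > 0"
        using G compact_imp_closed in_closed_iff_infdist_zero infdist_nonneg
        by (metis less_eq_real_def)
      obtain N where N: "1 / infdist y G < real N" using reals_Archimedean2 by blast
      have "h n y - indicator G y = 0" if "n \<ge> N" for n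
      proof -
        have "1 / infdist y G < real (Suc n)" using N that by linarith
        then have "1 < real (Suc n) * infdist y G" using pos by (simp add: divide_less_eq)
        then show ?thesis using False by (simp add: h_def)
      qed
      then show ?thesis by (intro tendsto_eventually) (auto simp: eventually_sequentially)
    qed
    then show "AE y in lborel. (\<lambda>n. h n y - indicator G y) \<longlonglongrightarrow> 0" by simp
    show "AE y in lborel. norm (h n y - indicator G y) \<le> h 0 y" for n
      using gap[of n] by (intro AE_I2) simp
  qed measurable
  obtain B where B: "\<And>x. \<bar>f x\<bar> \<le> B" using f unfolding bdd_supported_def by blast
  have close: "\<bar>convolution f (h n) x - convolution f (indicator G) x\<bar>
      \<le> B * (\<integral>y. h n y - indicator G y \<partial>lborel)" for n x
  proof -
    have i1: "integrable lborel (\<lambda>t. f t * h n (x - t))"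
      using bdd_supported_integrable[OF bdd_supported_mult[OF f h_bdd_supported, of 0 n x]] by simp
    have i2: "integrable lborel (\<lambda>t. f t * indicator G (x - t))"
      using bdd_supported_integrable[OF bdd_supported_mult[OF f bdd_supported_indicator[OF G(1)], of 0 x]] by simp
    have i3: "integrable lborel (\<lambda>t. h n (x - t) - indicator G (x - t))"
      using gap_int[of n] lborel_reflection(1)[of "\<lambda>y. h n y - indicator G y" x] by simp
    have "convolution f (h n) x - convolution f (indicator G) x
        = (\<integral>t. f t * (h n (x - t) - indicator G (x - t)) \<partial>lborel)"
      unfolding convolution_def right_diff_distrib
      by (rule Bochner_Integration.integral_diff[OF i1 i2, symmetric])
    also have "\<bar>\<dots>\<bar> \<le> (\<integral>t. \<bar>f t * (h n (x - t) - indicator G (x - t))\<bar> \<partial>lborel)"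
      by (rule integral_abs_bound)
    also have "\<dots> \<le> (\<integral>t. B * (h n (x - t) - indicator G (x - t)) \<partial>lborel)"
    proof (rule integral_mono)
      show "integrable lborel (\<lambda>t. \<bar>f t * (h n (x - t) - indicator G (x - t))\<bar>)"
        using Bochner_Integration.integrable_diff[OF i1 i2] by (simp add: right_diff_distrib)
      show "\<bar>f t * (h n (x - t) - indicator G (x - t))\<bar> \<le> B * (h n (x - t) - indicator G (x - t))" for t
        using gap(1)[of n "x - t"] B[of t] by (simp add: abs_mult mult_right_mono)
    qed (use i3 in simp)
    also have "\<dots> = B * (\<integral>y. h n y - indicator G y \<partial>lborel)"
      using lborel_reflection(2)[of "\<lambda>y. h n y - indicator G y" x] by simp
    finally show ?thesis .
  qed
  have "uniform_limit UNIV (\<lambda>n. convolution f (h n)) (convolution f (indicator G)) sequentially"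
  proof (rule uniform_limitI)
    fix e :: real assume "0 < e"
    have "(\<lambda>n. B * (\<integral>y. h n y - indicator G y \<partial>lborel)) \<longlonglongrightarrow> 0"
      using tendsto_mult_right_zero[of _ _ B] lim by simp
    then have "\<forall>\<^sub>F n in sequentially. B * (\<integral>y. h n y - indicator G y \<partial>lborel) < e"
      using \<open>0 < e\<close> by (rule order_tendstoD(2))
    then show "\<forall>\<^sub>F n in sequentially. \<forall>x\<in>UNIV. dist (convolution f (h n) x) (convolution f (indicator G) x) < e"
      by eventually_elim (auto simp: dist_real_def intro: le_less_trans[OF close])
  qed
  then show ?thesis
    by (rule uniform_limit_theorem[rotated])
       (auto intro!: always_eventually continuous_convolution f h_cont h_bdd_supported)
qed

lemma bear_tile_indicator_refinement:
  "AE x in lborel. indicator bear_tile x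
     = (indicator bear_tile (bear_map x) + indicator bear_tile (bear_map x - bear_e1) :: real)"
proof -
  let ?\<chi> = "indicator bear_tile :: _ \<Rightarrow> real"
  have bdd_supported: "bdd_supported ?\<chi>" by (rule bdd_supported_indicator[OF compact_bear_tile])
  note [measurable] = bdd_supported[THEN bdd_supported_measurable]
  note int = bdd_supported_integrable[OF bdd_supported]
  have i1: "integrable lborel (\<lambda>x. ?\<chi> (bear_map x))" "(\<integral>x. ?\<chi> (bear_map x) \<partial>lborel) = integral\<^sup>L lborel ?\<chi> / 2"
    using integral_bear_map[of ?\<chi>] int by auto
  have i2: "integrable lborel (\<lambda>x. ?\<chi> (bear_map x - bear_e1))"
    "(\<integral>x. ?\<chi> (bear_map x - bear_e1) \<partial>lborel) = integral\<^sup>L lborel ?\<chi> / 2"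
    using integral_bear_map[of "\<lambda>x. ?\<chi> (x - bear_e1)"] lborel_translation[of ?\<chi> bear_e1] int by auto
  \<comment> \<open>By self-similarity this is the indicator of the overlap of the two halves of the
    tile.\<close>
  let ?D = "\<lambda>x. ?\<chi> (bear_map x) + ?\<chi> (bear_map x - bear_e1) - ?\<chi> x"
  have "integral\<^sup>L lborel ?D = 0" using i1 i2 int by simp
  moreover have "integrable lborel ?D" using i1 i2 int by simp
  moreover have "0 \<le> ?D x" for x
    using bear_tile_self_similar[of x] by (auto simp: indicator_def)
  ultimately have "AE x in lborel. ?D x = 0"
    using integral_nonneg_eq_0_iff_AE[of lborel ?D] by simp
  then show ?thesis by eventually_elim simp
qed

text \<open>Substituting s = M t contributes the factor 1 / 2, and refining both factors of the
  integrand multiplies their masks. The integral ignores null sets, so equations valid almost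
  everywhere give one valid at every \<open>x\<close>.\<close>

lemma convolution_refinement:
  fixes f g :: "real^2 \<Rightarrow> real"
  assumes f: "bdd_supported f" "AE x in lborel. f x = (\<Sum>k\<le>m. c k * f (bear_map x - of_nat k *\<^sub>R bear_e1))"
    and g: "bdd_supported g" "AE x in lborel. g x = g (bear_map x) + g (bear_map x - bear_e1)"
  shows "convolution f g x = (\<Sum>k\<le>m. c k / 2 *
    (convolution f g (bear_map x - of_nat k *\<^sub>R bear_e1) + convolution f g (bear_map x - of_nat (Suc k) *\<^sub>R bear_e1)))"
proof -
  note [measurable] = f(1)[THEN bdd_supported_measurable] g(1)[THEN bdd_supported_measurable]
  let ?y = "bear_map x"
  define \<Phi> where "\<Phi> s = (\<Sum>k\<le>m. c k * f (s - of_nat k *\<^sub>R bear_e1)) * (g (?y - s) + g (?y - bear_e1 - s))" for s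
  have [measurable]: "\<Phi> \<in> borel_measurable borel" unfolding \<Phi>_def by measurable
  have shift: "(\<integral>s. f (s - a) * g (b - s) \<partial>lborel) = convolution f g (b - a)" for a b
  proof -
    have "(\<integral>s. f (s - a) * g (b - s) \<partial>lborel) = (\<integral>s. (\<lambda>u. f u * g (b - a - u)) (s - a) \<partial>lborel)"
      by (simp add: diff_diff_eq)
    also have "\<dots> = convolution f g (b - a)"
      unfolding convolution_def by (rule lborel_translation(2)) measurable
    finally show ?thesis .
  qed
  have int: "integrable lborel (\<lambda>s. f (s - a) * g (b - s))" for a b
    by (rule bdd_supported_integrable[OF bdd_supported_mult[OF f(1) g(1)]])
  have lin: "bear_map (x - t) = ?y - bear_map t" for t
    using linear_diff[OF linear_bear_map] .
  have "convolution f g x = (\<integral>t. \<Phi> (bear_map t) \<partial>lborel)"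
    unfolding convolution_def
  proof (rule integral_cong_AE)
    show "AE t in lborel. f t * g (x - t) = \<Phi> (bear_map t)"
      using f(2) AE_reflection[OF g(2), of x]
    proof eventually_elim
      case (elim t)
      have e: "?y - bear_map t - bear_e1 = ?y - bear_e1 - bear_map t" by simp
      show ?case unfolding elim(1) elim(2) lin e \<Phi>_def ..
    qed
  qed measurable
  also have "\<dots> = (\<integral>s. \<Phi> s \<partial>lborel) / 2" by (rule integral_bear_map(2)) measurable
  also have "(\<integral>s. \<Phi> s \<partial>lborel) = (\<integral>s. (\<Sum>k\<le>m. c k *
      (f (s - of_nat k *\<^sub>R bear_e1) * g (?y - s) + f (s - of_nat k *\<^sub>R bear_e1) * g (?y - bear_e1 - s))) \<partial>lborel)"
    by (simp add: \<Phi>_def sum_distrib_right distrib_left mult.assoc sum.distrib)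
  also have "\<dots> = (\<Sum>k\<le>m. c k * (convolution f g (?y - of_nat k *\<^sub>R bear_e1)
      + convolution f g (?y - bear_e1 - of_nat k *\<^sub>R bear_e1)))"
    by (subst Bochner_Integration.integral_sum)
       (auto simp: int shift intro!: Bochner_Integration.integrable_add integrable_mult_right)
  also have "\<dots> / 2 = (\<Sum>k\<le>m. c k / 2 * (convolution f g (?y - of_nat k *\<^sub>R bear_e1)
      + convolution f g (?y - of_nat (Suc k) *\<^sub>R bear_e1)))"
    unfolding sum_divide_distrib by (intro sum.cong refl) (simp add: scaleR_left_distrib diff_diff_eq)
  finally show ?thesis .
qed

text \<open>Pascal's rule in the form of multiplying the mask (1 + z)^m by one more factor 1 +
  z.\<close>

lemma sum_choose_Suc:
  "(\<Sum>k\<le>Suc m. real (Suc m choose k) * F k) = (\<Sum>k\<le>m. real (m choose k) * (F k + F (Suc k)))"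
proof -
  have "(\<Sum>k\<le>Suc m. real (Suc m choose k) * F k)
      = F 0 + (\<Sum>k\<le>m. (real (m choose Suc k) + real (m choose k)) * F (Suc k))"
    unfolding sum.atMost_Suc_shift by (simp add: add.commute)
  also have "\<dots> = (F 0 + (\<Sum>k\<le>m. real (m choose Suc k) * F (Suc k))) + (\<Sum>k\<le>m. real (m choose k) * F (Suc k))"
    by (simp add: distrib_right sum.distrib)
  also have "F 0 + (\<Sum>k\<le>m. real (m choose Suc k) * F (Suc k)) = (\<Sum>k\<le>Suc m. real (m choose k) * F k)"
    unfolding sum.atMost_Suc_shift[of _ m] by simp
  also have "\<dots> = (\<Sum>k\<le>m. real (m choose k) * F k)" by simp
  finally show ?thesis by (simp add: distrib_left sum.distrib)
qed

lemma bdd_supported_tile_bspline: "bdd_supported (tile_bspline bear_tile n)"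
  by (induction n) (simp_all add: bdd_supported_indicator bdd_supported_convolution compact_bear_tile)

lemma tile_bspline_refinement_step:
  assumes "AE x in lborel. tile_bspline bear_tile n x = (\<Sum>k\<le>Suc n. real (Suc n choose k) / 2 ^ n
    * tile_bspline bear_tile n (bear_map x - of_nat k *\<^sub>R bear_e1))"
  shows "tile_bspline bear_tile (Suc n) x = (\<Sum>k\<le>Suc (Suc n). real (Suc (Suc n) choose k) / 2 ^ Suc n
    * tile_bspline bear_tile (Suc n) (bear_map x - of_nat k *\<^sub>R bear_e1))"
proof -
  let ?F = "\<lambda>k. tile_bspline bear_tile (Suc n) (bear_map x - of_nat k *\<^sub>R bear_e1)"
  have "tile_bspline bear_tile (Suc n) x
      = (\<Sum>k\<le>Suc n. real (Suc n choose k) / 2 ^ n / 2 * (?F k + ?F (Suc k)))"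
    unfolding tile_bspline.simps(2)
    by (rule convolution_refinement[OF bdd_supported_tile_bspline assms bdd_supported_indicator[OF compact_bear_tile]
          bear_tile_indicator_refinement])
  also have "\<dots> = (\<Sum>k\<le>Suc n. real (Suc n choose k) * (?F k + ?F (Suc k))) / 2 ^ Suc n"
    by (simp add: sum_divide_distrib power_Suc2 del: power_Suc sum.atMost_Suc tile_bspline.simps)
  also have "\<dots> = (\<Sum>k\<le>Suc (Suc n). real (Suc (Suc n) choose k) * ?F k) / 2 ^ Suc n"
    by (simp only: sum_choose_Suc)
  finally show ?thesis by (simp add: sum_divide_distrib del: sum.atMost_Suc tile_bspline.simps binomial_Suc_Suc)
qed

text \<open>For \<open>n = 0\<close> the equation fails exactly where the two halves of the tile
  overlap, hence the form almost everywhere; one convolution makes it hold at every point.\<close>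

lemma tile_bspline_refinement_AE:
  "AE x in lborel. tile_bspline bear_tile n x = (\<Sum>k\<le>Suc n. real (Suc n choose k) / 2 ^ n
    * tile_bspline bear_tile n (bear_map x - of_nat k *\<^sub>R bear_e1))"
proof (induction n)
  case 0
  show ?case using bear_tile_indicator_refinement by simp
next
  case (Suc n)
  from tile_bspline_refinement_step[OF this] show ?case by (intro AE_I2)
qed

lemma tile_bspline_refinement:
  "tile_bspline bear_tile (Suc n) x = (\<Sum>k\<le>Suc (Suc n). real (Suc (Suc n) choose k) / 2 ^ Suc n
    * tile_bspline bear_tile (Suc n) (bear_map x - of_nat k *\<^sub>R bear_e1))"
  by (rule tile_bspline_refinement_step[OF tile_bspline_refinement_AE])

lemma continuous_tile_bspline: "continuous_on UNIV (tile_bspline bear_tile (Suc n))"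
  using zero_in_bear_tile
  by (auto intro!: continuous_convolution_indicator bdd_supported_tile_bspline compact_bear_tile)

text \<open>The number of convolution factors is q = \<open>Suc (Suc n)\<close>, and a certificate
  for q yields smoothness q - 1.\<close>

lemma times_cont_differentiable_tile_bspline:
  assumes cert: "contraction_certificate (Suc (Suc n)) ps C0 C1 Q W0 W1 W2"
  shows "times_cont_differentiable (Suc n) (tile_bspline bear_tile (Suc n))"
proof -
  let ?B = "tile_bspline bear_tile (Suc n)"
  define f where "f z = complex_of_real (?B (bear_vec z))" for z
  obtain F r where F: "\<And>x. \<bar>?B x\<bar> \<le> F" and r: "\<And>x. norm x > r \<Longrightarrow> ?B x = 0"
    using bdd_supported_tile_bspline[of "Suc n"] unfolding bdd_supported_def by blast
  obtain K where K: "K > 0" "\<And>x. norm (bear_coord x) \<le> norm x * K"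
    using bounded_linear.pos_bounded[OF bounded_linear_bear_coord] by blast
  interpret refinable f "Suc (Suc n)" "r * K" F
  proof
    show "norm (f z) \<le> F" for z using F by (simp add: f_def)
    show "f z = 0" if "norm z > r * K" for z
    proof -
      have "r * K < norm (bear_vec z) * K" using that K(2)[of "bear_vec z"] by simp
      then show ?thesis using K(1) r by (simp add: f_def)
    qed
    have "bear_vec (eig * z - of_nat k) = bear_map (bear_vec z) - of_nat k *\<^sub>R bear_e1" for z k
    proof -
      have "bear_coord (of_nat k *\<^sub>R bear_e1) = of_nat k"
        by (simp add: bear_coord_def)
      then have "bear_coord (bear_map (bear_vec z) - of_nat k *\<^sub>R bear_e1) = eig * z - of_nat k"
        by (simp only: bear_coord_diff bear_coord_map bear_coord_vec)
      then show ?thesis by (metis bear_vec_coord)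
    qed
    then show "f z = (\<Sum>k\<le>Suc (Suc n). of_real (real (Suc (Suc n) choose k) / 2 ^ (Suc (Suc n) - 1))
        * f (eig * z - of_nat k))" for z
      unfolding f_def by (subst tile_bspline_refinement)
        (simp del: sum.atMost_Suc tile_bspline.simps binomial_Suc_Suc)
  qed
  \<comment> \<open>The rate from the certificate; multiplied by \<open>sqrt 2 ^ Suc n\<close> it
    becomes sqrt (255 / 256), just below the critical value 1.\<close>
  define \<theta> where "\<theta> = sqrt (255 / 256 / 2 ^ Suc n)"
  have "times_cont_differentiable (Suc n) f"
  proof (rule times_cont_differentiable_of_diff_decay[where \<theta> = \<theta> and B = F])
    show "diff_decay f (Suc (Suc n)) \<theta>"
      using diff_iterated_subdivision_bound[OF cert]
      by (intro diff_decay_of_subdivision) (simp only: \<theta>_def diff_Suc_1)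
    show "0 < \<theta>" by (simp add: \<theta>_def)
    have "\<theta> * sqrt 2 ^ Suc n = sqrt (255 / 256)"
      unfolding \<theta>_def real_sqrt_power[symmetric] real_sqrt_mult[symmetric] by simp
    then show "\<theta> * sqrt 2 ^ Suc n < 1" by simp
    show "continuous_on UNIV f"
      unfolding f_def
      by (intro continuous_on_of_real continuous_on_compose2[OF continuous_tile_bspline]
          linear_continuous_on bounded_linear_bear_vec subset_UNIV)
  qed (rule bounded)
  then have "times_cont_differentiable (Suc n) (\<lambda>x. Re (f (bear_coord x)))"
    by (intro times_cont_differentiable_bounded_linear[OF bounded_linear_Re]
        times_cont_differentiable_compose_linear[OF bounded_linear_bear_coord])
  then show ?thesis by (simp add: f_def del: tile_bspline.simps)
qed

theorem theorem5:
  shows "times_cont_differentiable 2 (tile_bspline bear_tile 2) \<and>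
         times_cont_differentiable 3 (tile_bspline bear_tile 3)"
proof
  have "3 = Suc (Suc 1)" "4 = Suc (Suc 2)" "2 = Suc 1" "3 = Suc 2" by simp_all
  then show "times_cont_differentiable 2 (tile_bspline bear_tile 2)"
    "times_cont_differentiable 3 (tile_bspline bear_tile 3)"
    using times_cont_differentiable_tile_bspline certificate3 certificate4 by metis+
qed

end
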